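(* Let $t_0>0$. For any $x_0\in\mathcal{H}$ and $x_1\in\mathcal{H}$ there exists a unique strong global solution $x:[t_0,+\infty)\to\mathcal{H}$ of the dynamical system $$\ddot{x}(t)+\delta\sqrt{\epsilon(t)}\,\dot{x}(t)+\frac{1}{\gamma\sqrt{\epsilon(t)}}\frac{d}{dt}\big(\mathcal{A}_{\eta}x(t)+\epsilon(t)x(t)\big)+\mathcal{A}_{\eta}x(t)+\epsilon(t)x(t)=0$$ which satisfies the Cauchy data $x(t_0)=x_0$ and $\dot{x}(t_0)=x_1$.
   Context: $\mathcal{H}$ is a real Hilbert space. For $\mathcal{A}:\mathcal{H}\to2^{\mathcal{H}}$, $\operatorname{gra}\mathcal{A}=\{(x,u):u\in\mathcal{A}x\}$ and $\operatorname{zer}\mathcal{A}=\{x:0\in\mathcal{A}x\}$. For $\rho\in\mathbb{R}$, $\mathcal{A}$ is $\rho$-comonotone if $\langle x-y,u-v\rangle\ge\rho\|u-v\|^2$ for all $(x,u),(y,v)\in\operatorname{gra}\mathcal{A}$; it is maximally $\rho$-comonotone if moreover no $\rho$-comonotone operator has a graph properly containing $\operatorname{gra}\mathcal{A}$. For $\eta>0$, $J_\eta^{\mathcal{A}}=(Id+\eta\mathcal{A})^{-1}$ is the resolvent and $\mathcal{A}_\eta=\frac1\eta(Id-J_\eta^{\mathcal{A}})$ is the Yosida regularization. When $\mathcal{A}$ is maximally $\rho$-comonotone and $\eta>\max\{-2\rho,0\}$, both are single-valued and defined on all of $\mathcal{H}$. Standing assumptions: $\mathcal{A}:\mathcal{H}\to2^{\mathcal{H}}$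 is maximally $\rho$-comonotone with $\rho\in\mathbb{R}$ and $\operatorname{zer}\mathcal{A}\ne\emptyset$; $\eta>\max\{-2\rho,0\}$; $\delta>0$, $\gamma>0$; $\epsilon:[t_0,+\infty)\to(0,+\infty)$ is nonincreasing, of class $C^1$, $\ddot\epsilon(t)$ exists, and $\lim_{t\to+\infty}\epsilon(t)=0$. A strong global solution with Cauchy data $(x_0,x_1)\in\mathcal{H}\times\mathcal{H}$ is a function $x:[t_0,+\infty)\to\mathcal{H}$ such that: (i) $x$ and $\dot x$ are locally absolutely continuous, i.e. absolutely continuous on each $[t_0,T]$ with $t_0<T<+\infty$; (ii) the equation holds for almost every $t\in[t_0,+\infty)$; (iii) $x(t_0)=x_0$ and $\dot x(t_0)=x_1$. *)

theory Defs
  imports "HOL-Analysis.Analysis"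
begin

definition gra :: "('a \<Rightarrow> 'a set) \<Rightarrow> ('a \<times> 'a) set" where
  "gra A = {(x, u). u \<in> A x}"

definition zer :: "('a::zero \<Rightarrow> 'a set) \<Rightarrow> 'a set" where
  "zer A = {x. 0 \<in> A x}"

definition comonotone :: "real \<Rightarrow> ('a::real_inner \<Rightarrow> 'a set) \<Rightarrow> bool" where
  "comonotone \<rho> A \<longleftrightarrow>
     (\<forall>(x, u)\<in>gra A. \<forall>(y, v)\<in>gra A. (x - y) \<bullet> (u - v) \<ge> \<rho> * (norm (u - v))\<^sup>2)"

definition maximally_comonotone :: "real \<Rightarrow> ('a::real_inner \<Rightarrow> 'a set) \<Rightarrow> bool" where
  "maximally_comonotone \<rho> A \<longleftrightarrow>
     comonotone \<rho> A \<and> (\<nexists>B. comonotone \<rho> B \<and> gra A \<subset> gra B)"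

definition op_inverse :: "('a \<Rightarrow> 'a set) \<Rightarrow> 'a \<Rightarrow> 'a set" where
  "op_inverse A u = {x. u \<in> A x}"

definition resolvent :: "real \<Rightarrow> ('a::real_vector \<Rightarrow> 'a set) \<Rightarrow> 'a \<Rightarrow> 'a set" where
  "resolvent \<eta> A = op_inverse (\<lambda>x. {x + \<eta> *\<^sub>R u | u. u \<in> A x})"

definition yosida_set :: "real \<Rightarrow> ('a::real_vector \<Rightarrow> 'a set) \<Rightarrow> 'a \<Rightarrow> 'a set" where
  "yosida_set \<eta> A x = {(1 / \<eta>) *\<^sub>R (x - p) | p. p \<in> resolvent \<eta> A x}"

(* The point-valued Yosida regularization. It is meaningful only where yosida_set is a singleton,
   which is everywhere when A is maximally rho-comonotone and eta > max (- 2 * rho) 0. *)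
definition yosida :: "real \<Rightarrow> ('a::real_vector \<Rightarrow> 'a set) \<Rightarrow> 'a \<Rightarrow> 'a" where
  "yosida \<eta> A x = the_elem (yosida_set \<eta> A x)"

(* Epsilon-delta absolute continuity on [a, b]. A pair (c, d) in I stands for the subinterval
   [c, d]; the subintervals may share endpoints. *)
definition absolutely_continuous_on_interval ::
  "real \<Rightarrow> real \<Rightarrow> (real \<Rightarrow> 'a::real_normed_vector) \<Rightarrow> bool" where
  "absolutely_continuous_on_interval a b f \<longleftrightarrow>
     (\<forall>e>0. \<exists>d>0. \<forall>I.
        finite I \<and> (\<forall>(r, s)\<in>I. a \<le> r \<and> r \<le> s \<and> s \<le> b) \<and>
        disjoint_family_on (\<lambda>(r, s). {r<..<s}) I \<and> (\<Sum>(r, s)\<in>I. s - r) < d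
        \<longrightarrow> (\<Sum>(r, s)\<in>I. norm (f s - f r)) < e)"

definition locally_absolutely_continuous :: "real \<Rightarrow> (real \<Rightarrow> 'a::real_normed_vector) \<Rightarrow> bool" where
  "locally_absolutely_continuous t0 f \<longleftrightarrow> (\<forall>T>t0. absolutely_continuous_on_interval t0 T f)"

(* Derivatives are taken within [t0, infinity), hence one-sided at t0 and independent of the values
   of x outside this half-line. The function v is the derivative of x, required to exist everywhere
   since it has to be absolutely continuous on each [t0, T]; a and w are the values at t of the second derivative
   of x and of d/dt (A_eta x(t) + eps(t) x(t)), whose existence is part of the equation holding
   at t. *)
definition strong_global_solution ::
  "('a::real_inner \<Rightarrow> 'a set) \<Rightarrow> real \<Rightarrow> real \<Rightarrow> real \<Rightarrow> (real \<Rightarrow> real) \<Rightarrow> real \<Rightarrow> 'a \<Rightarrow> 'a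
     \<Rightarrow> (real \<Rightarrow> 'a) \<Rightarrow> bool" where
  "strong_global_solution A \<eta> \<delta> \<gamma> \<epsilon> t0 x0 x1 x \<longleftrightarrow>
     (\<exists>v. (\<forall>t\<ge>t0. (x has_vector_derivative v t) (at t within {t0..})) \<and>
       locally_absolutely_continuous t0 x \<and>
       locally_absolutely_continuous t0 v \<and>
       (AE t in lebesgue_on {t0..}. \<exists>a w.
          (v has_vector_derivative a) (at t within {t0..}) \<and>
          ((\<lambda>s. yosida \<eta> A (x s) + \<epsilon> s *\<^sub>R x s) has_vector_derivative w) (at t within {t0..}) \<and>
          a + (\<delta> * sqrt (\<epsilon> t)) *\<^sub>R v t + (1 / (\<gamma> * sqrt (\<epsilon> t))) *\<^sub>R w
            + yosida \<eta> A (x t) + \<epsilon> t *\<^sub>R x t = 0) \<and>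
       x t0 = x0 \<and> v t0 = x1)"

end

theory Submission
  imports Defs
begin

text \<open>
  By Minty's theorem, applied to the monotone operator \<open>A\<^sup>-\<^sup>1 - \<rho> Id\<close>, the map \<open>Y = A\<^sub>\<eta>\<close> is
  single-valued, everywhere defined and Lipschitz with constant \<open>1 / (\<eta> + \<rho>)\<close>. With
  \<open>b = 1 / (\<gamma> sqrt \<epsilon>)\<close> and \<open>g = Y x + \<epsilon> x\<close>, the new unknown \<open>y = x' + b g\<close> absorbs the derivative of
  \<open>g\<close>: the equation becomes
    \<open>x' = y - b g\<close>, \<open>y' = - \<delta> sqrt \<epsilon> x' + (b' - 1) g\<close>,
  a first-order system whose right-hand side is continuous in time and Lipschitz in \<open>(x, y)\<close>. It has
  exactly one global classical solution. Conversely, \<open>y\<close> is locally absolutely continuous along a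
  strong solution, so the system holds everywhere once it holds almost everywhere.

  For the classical solution, \<open>Y x\<close> is only known to be locally Lipschitz; that it is differentiable
  almost everywhere is the Radon-Nikodym property of Hilbert spaces. For Lipschitz \<open>f\<close> it follows from
  an \<open>L\<^sup>2\<close> argument: if a partition nearly maximizes the energy \<open>\<Sum> |\<Delta>f|\<^sup>2 / \<Delta>t\<close>, then the deviation of
  \<open>f\<close> from its piecewise linear interpolation has small energy on every family of disjoint intervals,
  and a Vitali covering bounds the measure of the set where the difference quotients oscillate.
\<close>

subsection \<open>Differentiability of Lipschitz curves in Hilbert spaces\<close>

inductive partition_energy :: "(real \<Rightarrow> 'a::real_inner) \<Rightarrow> real \<Rightarrow> real \<Rightarrow> real \<Rightarrow> bool"
  for f where
  cell: "a < b \<Longrightarrow> partition_energy f a b ((norm (f b - f a))\<^sup>2 / (b - a))"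
| join: "partition_energy f a b e \<Longrightarrow> partition_energy f b c e' \<Longrightarrow> partition_energy f a c (e + e')"

text \<open>For Lipschitz \<open>f\<close> and a < b this is the integral of |f'|^2, obtained
  without presupposing a derivative. \<open>partition_energy\<close> records only the values of the
  sums, so partitions themselves need no representation.\<close>

definition energy :: "(real \<Rightarrow> 'a::real_inner) \<Rightarrow> real \<Rightarrow> real \<Rightarrow> real" where
  "energy f a b = Sup {e. partition_energy f a b e}"

lemma partition_energy_less: "partition_energy f a b e \<Longrightarrow> a < b"
  by (induction rule: partition_energy.induct) auto

lemma partition_energy_le:
  assumes "L-lipschitz_on UNIV f" "partition_energy f a b e"
  shows "e \<le> L\<^sup>2 * (b - a)"
  using assms(2)
proof (induction rule: partition_energy.induct)
  case (cell a b)
  have "norm (f b - f a) \<le> L * (b - a)"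
    using lipschitz_on_normD[OF assms(1), of b a] cell by simp
  then have "(norm (f b - f a))\<^sup>2 \<le> (L * (b - a))\<^sup>2"
    by (intro power_mono) auto
  then show ?case using cell by (simp add: divide_simps power2_eq_square mult_ac)
qed (simp add: algebra_simps)

text \<open>Multiplied by s t (s + t), the difference of the two sides is |t u - s v|^2.
  Consequently refining a partition never lowers its energy.\<close>

lemma norm_add_square_div_le:
  fixes u v :: "'a::real_inner"
  assumes "s > 0" "t > 0"
  shows "(norm (u + v))\<^sup>2 / (s + t) \<le> (norm u)\<^sup>2 / s + (norm v)\<^sup>2 / t"
proof -
  have "0 \<le> (norm (t *\<^sub>R u - s *\<^sub>R v))\<^sup>2" by simp
  also have "\<dots> = t\<^sup>2 * (norm u)\<^sup>2 - 2 * s * t * (u \<bullet> v) + s\<^sup>2 * (norm v)\<^sup>2"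
    unfolding power2_norm_eq_inner
    by (simp add: inner_diff_left inner_diff_right inner_commute algebra_simps power2_eq_square)
  finally have *: "2 * s * t * (u \<bullet> v) \<le> t\<^sup>2 * (norm u)\<^sup>2 + s\<^sup>2 * (norm v)\<^sup>2" by simp
  have "(norm (u + v))\<^sup>2 = (norm u)\<^sup>2 + 2 * (u \<bullet> v) + (norm v)\<^sup>2"
    by (simp add: power2_norm_eq_inner inner_add_left inner_add_right inner_commute)
  then have "(norm (u + v))\<^sup>2 * (s * t) \<le> ((norm u)\<^sup>2 * t + (norm v)\<^sup>2 * s) * (s + t)"
    using * by (simp add: algebra_simps power2_eq_square)
  then show ?thesis using assms by (simp add: field_simps)
qed

text \<open>Inserting \<open>b\<close> changes at most the one cell that contains it in its
  interior, and there \<open>norm_add_square_div_le\<close> applies.\<close>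

lemma partition_energy_split:
  assumes "partition_energy f a c e" "a < b" "b < c"
  shows "\<exists>e1 e2. partition_energy f a b e1 \<and> partition_energy f b c e2 \<and> e \<le> e1 + e2"
  using assms
proof (induction rule: partition_energy.induct)
  case (cell a c)
  have "(norm (f c - f a))\<^sup>2 / (c - a) \<le> (norm (f b - f a))\<^sup>2 / (b - a) + (norm (f c - f b))\<^sup>2 / (c - b)"
    using norm_add_square_div_le[of "b - a" "c - b" "f b - f a" "f c - f b"] cell by simp
  then show ?case using cell by (blast intro: partition_energy.cell)
next
  case (join a d e c e')
  consider "b < d" | "b = d" | "b > d" by linarith
  then show ?case
  proof cases
    case 1
    with join obtain e1 e2 where "partition_energy f a b e1" "partition_energy f b d e2" "e \<le> e1 + e2"
      by blast
    moreover have "partition_energy f b c (e2 + e')"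
      using calculation join by (blast intro: partition_energy.join)
    ultimately show ?thesis by (intro exI[of _ e1] exI[of _ "e2 + e'"]) auto
  next
    case 2 then show ?thesis using join by blast
  next
    case 3
    with join obtain e1 e2 where "partition_energy f d b e1" "partition_energy f b c e2" "e' \<le> e1 + e2"
      by blast
    moreover have "partition_energy f a b (e + e1)"
      using calculation join by (blast intro: partition_energy.join)
    ultimately show ?thesis by (intro exI[of _ "e + e1"] exI[of _ e2]) auto
  qed
qed

context
  fixes f :: "real \<Rightarrow> 'a::real_inner" and L :: real
  assumes lip: "L-lipschitz_on UNIV f"
begin

lemma partition_energy_le_energy: "partition_energy f a b e \<Longrightarrow> e \<le> energy f a b"
  unfolding energy_def using partition_energy_le[OF lip]
  by (intro cSup_upper) (auto intro!: bdd_aboveI)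

lemma energy_ge_cell: "a < b \<Longrightarrow> (norm (f b - f a))\<^sup>2 / (b - a) \<le> energy f a b"
  by (intro partition_energy_le_energy partition_energy.cell)

lemma energy_approx:
  assumes "a < b" "\<theta> > 0"
  shows "\<exists>e. partition_energy f a b e \<and> energy f a b - \<theta> < e"
proof -
  have "{e. partition_energy f a b e} \<noteq> {}" using partition_energy.cell[OF assms(1)] by blast
  moreover have "bdd_above {e. partition_energy f a b e}"
    using partition_energy_le[OF lip] by (auto intro!: bdd_aboveI)
  ultimately show ?thesis
    using less_cSup_iff[of "{e. partition_energy f a b e}" "energy f a b - \<theta>"] assms(2)
    by (auto simp: energy_def)
qed

text \<open>A nearly optimal partition of the whole interval is split at \<open>b\<close>;
  conversely, nearly optimal partitions of the two halves are joined.\<close>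

lemma energy_additive:
  assumes "a < b" "b < c"
  shows "energy f a c = energy f a b + energy f b c"
proof (rule antisym)
  show "energy f a c \<le> energy f a b + energy f b c"
  proof (rule field_le_epsilon)
    fix \<theta> :: real assume "\<theta> > 0"
    then obtain e where e: "partition_energy f a c e" "energy f a c - \<theta> < e"
      using energy_approx[of a c \<theta>] assms by auto
    then obtain e1 e2 where "partition_energy f a b e1" "partition_energy f b c e2" "e \<le> e1 + e2"
      using partition_energy_split assms by blast
    then show "energy f a c \<le> energy f a b + energy f b c + \<theta>"
      using e partition_energy_le_energy[of a b e1] partition_energy_le_energy[of b c e2] by linarith
  qed
  show "energy f a b + energy f b c \<le> energy f a c"
  proof (rule field_le_epsilon)
    fix \<theta> :: real assume "\<theta> > 0"
    then obtain e1 e2 where e: "partition_energy f a b e1" "energy f a b - \<theta>/2 < e1"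
      "partition_energy f b c e2" "energy f b c - \<theta>/2 < e2"
      using energy_approx[of a b "\<theta>/2"] energy_approx[of b c "\<theta>/2"] assms by auto
    then show "energy f a b + energy f b c \<le> energy f a c + \<theta>"
      using partition_energy_le_energy[OF partition_energy.join[OF e(1,3)]] by (simp add: field_simps)
  qed
qed

end

section \<open>Vitali covering of the points with large deviation from a mean slope\<close>

lemma superadditive_sum_disjoint_le:
  fixes G :: "real \<Rightarrow> real \<Rightarrow> real" and l r :: "'i \<Rightarrow> real"
  assumes add: "\<And>a b c. a < b \<Longrightarrow> b < c \<Longrightarrow> G a b + G b c \<le> G a c"
    and nonneg: "\<And>a b. a < b \<Longrightarrow> 0 \<le> G a b"
  assumes "finite I" "c < d"
    "\<And>i. i \<in> I \<Longrightarrow> c \<le> l i \<and> l i < r i \<and> r i \<le> d"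
    "pairwise (\<lambda>i j. disjnt {l i..r i} {l j..r j}) I"
  shows "(\<Sum>i\<in>I. G (l i) (r i)) \<le> G c d"
  using assms(3-)
proof (induction I arbitrary: d rule: finite_psubset_induct)
  case (psubset I)
  have mono: "G a b \<le> G c d" if "c \<le> a" "a < b" "b \<le> d" for a b c d
  proof -
    have "G a b \<le> G c b"
      using add[of c a b] nonneg[of c a] that by (cases "c = a") auto
    also have "\<dots> \<le> G c d"
      using add[of c b d] nonneg[of b d] that by (cases "b = d") auto
    finally show ?thesis .
  qed
  show ?case
  proof (cases "I = {}")
    case True
    then show ?thesis using nonneg psubset by simp
  next
    case False
    \<comment> \<open>The interval reaching furthest to the right is removed. By disjointness of the
      closed intervals all others end strictly before it begins, so the induction hypothesis applies
      to them on [c, \<open>l i\<close>].\<close>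
    obtain i where i: "i \<in> I" and imax: "\<And>j. j \<in> I \<Longrightarrow> r j \<le> r i"
      using psubset.hyps False Max_in[of "r ` I"] Max_ge[of "r ` I"]
      by (metis (no_types, lifting) finite_imageI imageE image_eqI image_is_empty)
    note ii = psubset.prems(2)[OF i]
    let ?J = "I - {i}"
    have left: "r j < l i" if "j \<in> ?J" for j
    proof (rule ccontr)
      assume "\<not> r j < l i"
      then have "r j \<in> {l i..r i}" "r j \<in> {l j..r j}"
        using imax[of j] psubset.prems(2)[of j] that by auto
      moreover have "disjnt {l i..r i} {l j..r j}"
        using psubset.prems(3) i that by (auto simp: pairwise_def)
      ultimately show False by (auto simp: disjnt_def)
    qed
    have "(\<Sum>j\<in>?J. G (l j) (r j)) + G (l i) (r i) \<le> G c (r i)"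
    proof (cases "?J = {}")
      case True
      then show ?thesis using mono[of c "l i" "r i" "r i"] ii by (simp only: True sum.empty) auto
    next
      case False
      then obtain j where "j \<in> ?J" by blast
      then have "c < l i" using left[of j] psubset.prems(2)[of j] by auto
      have "(\<Sum>j\<in>?J. G (l j) (r j)) \<le> G c (l i)"
      proof (rule psubset.IH)
        show "?J \<subset> I" using i by blast
        show "c < l i" by fact
        show "pairwise (\<lambda>i j. disjnt {l i..r i} {l j..r j}) ?J"
          using psubset.prems(3) by (rule pairwise_subset) auto
        show "\<And>j. j \<in> ?J \<Longrightarrow> c \<le> l j \<and> l j < r j \<and> r j \<le> l i"
          using psubset.prems(2) left by force
      qed
      then show ?thesis using add[of c "l i" "r i"] ii \<open>c < l i\<close> by linarith
    qed
    also have "\<dots> \<le> G c d" using mono[of c c "r i" d] ii by auto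
    finally show ?thesis using i psubset.hyps by (simp add: sum.remove add.commute)
  qed
qed

text \<open>An interval on which the mean slope of \<open>f\<close> differs from \<open>m\<close> by
  more than \<mu> carries deviation energy at least \<mu>^2 times its length. Disjoint intervals of
  this kind therefore have total length at most the energy excess of [c, d] over its single cell,
  divided by \<mu>^2. The factor 5 is the enlargement in Vitali's lemma.\<close>

lemma deviation_cover:
  fixes f :: "real \<Rightarrow> 'a::real_inner"
  assumes lip: "L-lipschitz_on UNIV f" and "c < d" "\<mu> > 0"
    and m: "m = (1 / (d - c)) *\<^sub>R (f d - f c)"
  shows "\<exists>T. T \<in> lmeasurable \<and>
     measure lebesgue T \<le> 5 / \<mu>\<^sup>2 * (energy f c d - (norm (f d - f c))\<^sup>2 / (d - c)) \<and>
     {t \<in> {c..d}. \<exists>s\<in>{c..d}. norm (f s - f t - (s - t) *\<^sub>R m) > \<mu> * \<bar>s - t\<bar>} \<subseteq> T"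
proof -
  let ?E = "energy f c d - (norm (f d - f c))\<^sup>2 / (d - c)"
  \<comment> \<open>This is the energy of \<open>f t - t *\<^sub>R m\<close>. It inherits additivity
    from \<open>energy\<close>, and for the mean slope \<open>m\<close> of [c, d] its value there is
    exactly the energy excess.\<close>
  define G where "G a b = energy f a b - 2 * (m \<bullet> (f b - f a)) + (norm m)\<^sup>2 * (b - a)" for a b
  have Gadd: "G a b + G b c = G a c" if "a < b" "b < c" for a b c
    using energy_additive[OF lip that] by (simp add: G_def algebra_simps)
  have Gge: "(norm (f b - f a - (b - a) *\<^sub>R m))\<^sup>2 / (b - a) \<le> G a b" if "a < b" for a b
  proof -
    have "(norm (f b - f a - (b - a) *\<^sub>R m))\<^sup>2
        = (norm (f b - f a))\<^sup>2 - 2 * (b - a) * (m \<bullet> (f b - f a)) + (b - a)\<^sup>2 * (norm m)\<^sup>2"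
      unfolding power2_norm_eq_inner
      by (simp add: inner_diff_left inner_diff_right inner_commute algebra_simps power2_eq_square)
    then have "(norm (f b - f a - (b - a) *\<^sub>R m))\<^sup>2 / (b - a)
        = (norm (f b - f a))\<^sup>2 / (b - a) - 2 * (m \<bullet> (f b - f a)) + (norm m)\<^sup>2 * (b - a)"
      using that by (simp add: field_simps power2_eq_square)
    then show ?thesis using energy_ge_cell[OF lip that] by (simp add: G_def)
  qed
  have G0: "0 \<le> G a b" if "a < b" for a b
    using Gge[OF that] that by (meson diff_ge_0_iff_ge divide_nonneg_nonneg less_imp_le order_trans zero_le_power2)
  have Gcd: "G c d = ?E"
  proof -
    have "m \<bullet> (f d - f c) = (norm (f d - f c))\<^sup>2 / (d - c)"
      by (simp add: m power2_norm_eq_inner)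
    moreover have "(norm m)\<^sup>2 * (d - c) = (norm (f d - f c))\<^sup>2 / (d - c)"
      using \<open>c < d\<close> by (simp add: m power2_eq_square divide_simps)
    ultimately show ?thesis by (simp add: G_def)
  qed
  \<comment> \<open>The intervals of large deviation, read as closed balls with centre
    \<open>cen\<close> and radius \<open>rad\<close> in order to apply Vitali's lemma.\<close>
  define K where "K = {(l, r). c \<le> l \<and> l < r \<and> r \<le> d \<and>
     norm (f r - f l - (r - l) *\<^sub>R m) > \<mu> * (r - l)}"
  define cen where "cen = (\<lambda>(l, r). (l + r) / 2 :: real)"
  define rad where "rad = (\<lambda>(l, r). (r - l) / 2 :: real)"
  have cb: "cball (cen i) (rad i) = {fst i..snd i}" for i
    by (auto simp: cen_def rad_def cball_eq_atLeastAtMost field_simps split: prod.splits)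
  have rad: "0 < rad i \<and> rad i \<le> d - c" if "i \<in> K" for i
    using that by (auto simp: K_def rad_def)
  obtain C where C: "countable C" "C \<subseteq> K"
     "pairwise (\<lambda>i j. disjnt (cball (cen i) (rad i)) (cball (cen j) (rad j))) C"
     "\<And>i. i \<in> K \<Longrightarrow> \<exists>j. j \<in> C \<and> \<not> disjnt (cball (cen i) (rad i)) (cball (cen j) (rad j)) \<and>
                        cball (cen i) (rad i) \<subseteq> ball (cen j) (5 * rad j)"
    by (rule Vitali_covering_lemma_cballs_balls[of K rad "d - c" cen]) (erule rad, rule that)
  have bound: "measure lebesgue (\<Union>i\<in>I. ball (cen i) (5 * rad i)) \<le> 5 / \<mu>\<^sup>2 * ?E"
    if I: "I \<subseteq> C" "finite I" for I
  proof -
    have IK: "\<And>i. i \<in> I \<Longrightarrow> i \<in> K" using I C by blast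
    have len: "snd i - fst i \<le> G (fst i) (snd i) / \<mu>\<^sup>2" if "i \<in> I" for i
    proof -
      obtain l r where lr: "i = (l, r)" by force
      have "l < r" "norm (f r - f l - (r - l) *\<^sub>R m) > \<mu> * (r - l)"
        using IK[OF that] lr by (auto simp: K_def)
      then have "(\<mu> * (r - l))\<^sup>2 \<le> (norm (f r - f l - (r - l) *\<^sub>R m))\<^sup>2"
        using \<open>\<mu> > 0\<close> by (intro power_mono) auto
      then have "(\<mu> * (r - l))\<^sup>2 / (r - l) \<le> G l r"
        using \<open>l < r\<close> by (intro order_trans[OF _ Gge]) (auto simp: divide_right_mono)
      moreover have "(\<mu> * (r - l))\<^sup>2 / (r - l) = \<mu>\<^sup>2 * (r - l)"
        using \<open>l < r\<close> by (simp add: power2_eq_square)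
      ultimately show ?thesis using \<open>\<mu> > 0\<close> lr by (simp add: field_simps)
    qed
    have "measure lebesgue (\<Union>i\<in>I. ball (cen i) (5 * rad i))
        \<le> (\<Sum>i\<in>I. measure lebesgue (ball (cen i) (5 * rad i)))"
      using I by (intro measure_UNION_le) auto
    also have "\<dots> = (\<Sum>i\<in>I. 5 * (snd i - fst i))"
    proof (rule sum.cong[OF refl])
      fix i assume "i \<in> I"
      from IK[OF this] obtain l r where lr: "i = (l, r)" "l < r" by (auto simp: K_def)
      have "cen i - 5 * rad i = 3 * l - 2 * r" "cen i + 5 * rad i = 3 * r - 2 * l"
        by (simp_all add: lr cen_def rad_def field_simps)
      then have "ball (cen i) (5 * rad i) = {3 * l - 2 * r <..< 3 * r - 2 * l}"
        by (simp add: ball_eq_greaterThanLessThan)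
      then show "measure lebesgue (ball (cen i) (5 * rad i)) = 5 * (snd i - fst i)"
        using lr by simp
    qed
    also have "\<dots> \<le> (\<Sum>i\<in>I. 5 / \<mu>\<^sup>2 * G (fst i) (snd i))"
    proof (rule sum_mono)
      fix i assume "i \<in> I"
      from len[OF this] show "5 * (snd i - fst i) \<le> 5 / \<mu>\<^sup>2 * G (fst i) (snd i)" by simp
    qed
    also have "\<dots> = 5 / \<mu>\<^sup>2 * (\<Sum>i\<in>I. G (fst i) (snd i))" by (simp add: sum_distrib_left)
    also have "\<dots> \<le> 5 / \<mu>\<^sup>2 * G c d"
    proof (rule mult_left_mono)
      show "(\<Sum>i\<in>I. G (fst i) (snd i)) \<le> G c d"
      proof (rule superadditive_sum_disjoint_le[of G I c d fst snd])
        show "pairwise (\<lambda>i j. disjnt {fst i..snd i} {fst j..snd j}) I"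
          using pairwise_subset[OF C(3) I(1)] by (simp add: cb)
        show "c \<le> fst i \<and> fst i < snd i \<and> snd i \<le> d" if "i \<in> I" for i
          using IK[OF that] by (auto simp: K_def)
      qed (use I \<open>c < d\<close> G0 Gadd in auto)
    qed simp
    finally show ?thesis by (simp add: Gcd)
  qed
  let ?T = "\<Union>i\<in>C. ball (cen i) (5 * rad i)"
  have "?T \<in> lmeasurable" "measure lebesgue ?T \<le> 5 / \<mu>\<^sup>2 * ?E"
    using fmeasurable_UN_bound[OF C(1) _ bound] measure_UN_bound[OF C(1) _ bound] by auto
  moreover have "{t \<in> {c..d}. \<exists>s\<in>{c..d}. norm (f s - f t - (s - t) *\<^sub>R m) > \<mu> * \<bar>s - t\<bar>} \<subseteq> ?T"
  proof clarify
    fix t s assume ts: "t \<in> {c..d}" "s \<in> {c..d}" "norm (f s - f t - (s - t) *\<^sub>R m) > \<mu> * \<bar>s - t\<bar>"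
    then have "s \<noteq> t" by auto
    \<comment> \<open>The deviation is symmetric in \<open>s\<close> and \<open>t\<close>, so the
      two points may be sorted. The interval they span contains \<open>t\<close> and lies in one of
      the enlarged balls.\<close>
    have "(min s t, max s t) \<in> K"
    proof (cases "t < s")
      case True then show ?thesis using ts by (auto simp: K_def)
    next
      case False
      have "norm (f t - f s - (t - s) *\<^sub>R m) = norm (f s - f t - (s - t) *\<^sub>R m)"
        by (subst norm_minus_commute[symmetric]) (simp add: algebra_simps)
      then show ?thesis using False ts \<open>s \<noteq> t\<close> by (auto simp: K_def)
    qed
    from C(4)[OF this] obtain j where "j \<in> C"
      "cball (cen (min s t, max s t)) (rad (min s t, max s t)) \<subseteq> ball (cen j) (5 * rad j)" by blast
    moreover from this(2) have "t \<in> ball (cen j) (5 * rad j)"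
      unfolding cb by (rule subsetD) auto
    ultimately show "t \<in> ?T" by blast
  qed
  ultimately show ?thesis by blast
qed

text \<open>Outside this set a single slope \<open>m\<close>, possibly depending on \<mu>,
  approximates all difference quotients near \<open>t\<close> up to \<mu>. Quantifying over
  \<open>m\<close> avoids mentioning a derivative; in a complete space one exists at
  \<open>t\<close> exactly when \<open>t\<close> is oscillating for no \<mu> > 0.\<close>

definition oscillating :: "real \<Rightarrow> (real \<Rightarrow> 'a::real_normed_vector) \<Rightarrow> real set" where
  "oscillating \<mu> f = {t. \<forall>m. \<forall>r>0. \<exists>s. \<bar>s - t\<bar> < r \<and> norm (f s - f t - (s - t) *\<^sub>R m) > \<mu> * \<bar>s - t\<bar>}"

text \<open>Oscillation excludes every slope, in particular the mean slope of the partition cell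
  around the point, so \<open>deviation_cover\<close> applies cell by cell. Since the energy is
  additive, the excesses of the cells add up to \<open>energy f a b - e\<close>.\<close>

lemma oscillating_cover:
  fixes f :: "real \<Rightarrow> 'a::real_inner"
  assumes lip: "L-lipschitz_on UNIV f" and "\<mu> > 0" and "partition_energy f a b e"
  shows "\<exists>T. T \<in> lmeasurable \<and> measure lebesgue T \<le> 5 / \<mu>\<^sup>2 * (energy f a b - e) \<and>
     oscillating \<mu> f \<inter> {a..b} \<subseteq> T"
  using assms(3)
proof (induction rule: partition_energy.induct)
  case (cell c d)
  define m where "m = (1 / (d - c)) *\<^sub>R (f d - f c)"
  obtain T where T: "T \<in> lmeasurable"
     "measure lebesgue T \<le> 5 / \<mu>\<^sup>2 * (energy f c d - (norm (f d - f c))\<^sup>2 / (d - c))"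
     "{t \<in> {c..d}. \<exists>s\<in>{c..d}. norm (f s - f t - (s - t) *\<^sub>R m) > \<mu> * \<bar>s - t\<bar>} \<subseteq> T"
    using deviation_cover[OF lip cell \<open>\<mu> > 0\<close> m_def] by blast
  \<comment> \<open>The point \<open>s\<close> has to stay in the cell, so the radius is the
    distance of \<open>t\<close> to the nearer endpoint. The endpoints themselves have no such
    radius and are added as a null set.\<close>
  have "oscillating \<mu> f \<inter> {c..d} \<subseteq> T \<union> {c, d}"
  proof (rule subsetI, rule ccontr)
    fix t assume t: "t \<in> oscillating \<mu> f \<inter> {c..d}" "t \<notin> T \<union> {c, d}"
    then have "min (t - c) (d - t) > 0" by auto
    moreover have "\<forall>m. \<forall>r>0. \<exists>s. \<bar>s - t\<bar> < r \<and> norm (f s - f t - (s - t) *\<^sub>R m) > \<mu> * \<bar>s - t\<bar>"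
      using t by (simp add: oscillating_def)
    ultimately obtain s where s: "\<bar>s - t\<bar> < min (t - c) (d - t)"
      "norm (f s - f t - (s - t) *\<^sub>R m) > \<mu> * \<bar>s - t\<bar>"
      by blast
    then have "s \<in> {c..d}" by auto
    with s t have "t \<in> T" by (intro subsetD[OF T(3)]) blast
    with t show False by simp
  qed
  moreover have "T \<union> {c, d} \<in> lmeasurable" 
    using fmeasurable.Un[OF T(1) negligible_imp_measurable[of "{c, d}"]] by simp
  moreover have "measure lebesgue (T \<union> {c, d}) = measure lebesgue T"
    using T by (intro measure_Un_null_set) (auto simp: negligible_iff_null_sets[symmetric])
  ultimately show ?case using T by metis
next
  case (join a b e c e')
  obtain S T where S: "S \<in> lmeasurable" "measure lebesgue S \<le> 5 / \<mu>\<^sup>2 * (energy f a b - e)"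
     "oscillating \<mu> f \<inter> {a..b} \<subseteq> S"
     and T: "T \<in> lmeasurable" "measure lebesgue T \<le> 5 / \<mu>\<^sup>2 * (energy f b c - e')"
     "oscillating \<mu> f \<inter> {b..c} \<subseteq> T" using join.IH by blast
  have "measure lebesgue (S \<union> T) \<le> 5 / \<mu>\<^sup>2 * (energy f a b - e) + 5 / \<mu>\<^sup>2 * (energy f b c - e')"
    using measure_Un_le[of S lebesgue T] S T by (auto simp: fmeasurableD)
  also have "\<dots> = 5 / \<mu>\<^sup>2 * (energy f a c - (e + e'))"
    using energy_additive[OF lip, of a b c] join.hyps partition_energy_less
    by (metis (no_types, lifting) add_diff_add distrib_left)
  finally have "measure lebesgue (S \<union> T) \<le> 5 / \<mu>\<^sup>2 * (energy f a c - (e + e'))" .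
  moreover have "S \<union> T \<in> lmeasurable" using S T by (intro fmeasurable.Un)
  moreover have "oscillating \<mu> f \<inter> {a..c} \<subseteq> S \<union> T"
  proof
    fix x assume "x \<in> oscillating \<mu> f \<inter> {a..c}"
    then show "x \<in> S \<union> T" using S(3) T(3) by (cases "x \<le> b") auto
  qed
  ultimately show ?case by blast
qed

lemma negligible_oscillating:
  fixes f :: "real \<Rightarrow> 'a::real_inner"
  assumes lip: "L-lipschitz_on UNIV f" and "\<mu> > 0" "a < b"
  shows "negligible (oscillating \<mu> f \<inter> {a..b})"
  unfolding negligible_outer_le
proof (intro allI impI)
  fix \<theta> :: real assume "\<theta> > 0"
  \<comment> \<open>An energy deficit below this value turns the bound of
    \<open>oscillating_cover\<close> into \<theta>.\<close>
  then have "\<theta> * \<mu>\<^sup>2 / 5 > 0" using \<open>\<mu> > 0\<close> by simp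
  then obtain e where e: "partition_energy f a b e" "energy f a b - \<theta> * \<mu>\<^sup>2 / 5 < e"
    using energy_approx[OF lip \<open>a < b\<close>] by blast
  then obtain T where "T \<in> lmeasurable" "measure lebesgue T \<le> 5 / \<mu>\<^sup>2 * (energy f a b - e)"
     "oscillating \<mu> f \<inter> {a..b} \<subseteq> T" using oscillating_cover[OF lip \<open>\<mu> > 0\<close>] by blast
  moreover have "5 / \<mu>\<^sup>2 * (energy f a b - e) \<le> 5 / \<mu>\<^sup>2 * (\<theta> * \<mu>\<^sup>2 / 5)"
    using e by (intro mult_left_mono) auto
  ultimately show "\<exists>T. oscillating \<mu> f \<inter> {a..b} \<subseteq> T \<and> T \<in> lmeasurable \<and> measure lebesgue T \<le> \<theta>"
    using \<open>\<mu> > 0\<close> by (intro exI[of _ T]) auto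
qed

text \<open>Slopes that fit \<open>f\<close> at \<open>t\<close> up to 1/(n+1) and 1/(k+1) differ by
  at most the sum of these errors. They form a Cauchy sequence, and its limit is the
  derivative.\<close>

lemma has_vector_derivative_if_not_oscillating:
  fixes f :: "real \<Rightarrow> 'a::{real_normed_vector, complete_space}"
  assumes "\<And>n. t \<notin> oscillating (1 / real (Suc n)) f"
  shows "\<exists>D. (f has_vector_derivative D) (at t)"
proof -
  have "\<exists>m r. r > 0 \<and> (\<forall>s. \<bar>s - t\<bar> < r \<longrightarrow>
      norm (f s - f t - (s - t) *\<^sub>R m) \<le> 1 / real (Suc n) * \<bar>s - t\<bar>)" for n
    using assms[of n] unfolding oscillating_def mem_Collect_eq by (meson not_less)
  then obtain m r where r: "\<And>n. r n > 0" and m: "\<And>n s. \<bar>s - t\<bar> < r n \<Longrightarrow>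
      norm (f s - f t - (s - t) *\<^sub>R m n) \<le> 1 / real (Suc n) * \<bar>s - t\<bar>"
    by metis
  have diff: "norm (m n - m k) \<le> 1 / real (Suc n) + 1 / real (Suc k)" for n k
  proof -
    \<comment> \<open>A step length at which both approximations are valid, so that they can be
      compared.\<close>
    define h where "h = min (r n) (r k) / 2"
    have h: "h > 0" "h < r n" "h < r k" using r[of n] r[of k] by (auto simp: h_def min_def)
    have "norm (h *\<^sub>R (m n - m k)) = norm ((f (t + h) - f t - h *\<^sub>R m k) - (f (t + h) - f t - h *\<^sub>R m n))"
      by (simp add: algebra_simps)
    also have "\<dots> \<le> norm (f (t + h) - f t - h *\<^sub>R m k) + norm (f (t + h) - f t - h *\<^sub>R m n)"
      by (rule norm_triangle_ineq4)
    also have "\<dots> \<le> 1 / real (Suc k) * h + 1 / real (Suc n) * h"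
      using m[of "t + h" k] m[of "t + h" n] h by auto
    finally have "h * norm (m n - m k) \<le> h * (1 / real (Suc n) + 1 / real (Suc k))"
      using h by (simp add: distrib_left del: of_nat_Suc)
    then show ?thesis using h by (simp only: mult_le_cancel_left_pos)
  qed
  have lim0: "(\<lambda>n. 1 / real (Suc n)) \<longlonglongrightarrow> 0"
    using LIMSEQ_inverse_real_of_nat by (simp add: inverse_eq_divide)
  have "Cauchy m"
  proof (rule CauchyI)
    fix e :: real assume "e > 0"
    then obtain N where N: "\<And>n. n \<ge> N \<Longrightarrow> 1 / real (Suc n) < e / 2"
      using LIMSEQ_D[OF lim0, of "e / 2"] by auto
    show "\<exists>M. \<forall>i\<ge>M. \<forall>n\<ge>M. norm (m i - m n) < e"
    proof (intro exI allI impI)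
      fix i n assume "N \<le> i" "N \<le> n"
      then show "norm (m i - m n) < e" using diff[of i n] N[of i] N[of n] by linarith
    qed
  qed
  then obtain D where D: "m \<longlonglongrightarrow> D" using Cauchy_convergent convergent_def by blast
  have mD: "norm (m n - D) \<le> 1 / real (Suc n)" for n
  proof (rule tendsto_le[OF _ _ tendsto_norm[OF tendsto_diff[OF tendsto_const D]]])
    show "(\<lambda>k. 1 / real (Suc n) + 1 / real (Suc k)) \<longlonglongrightarrow> 1 / real (Suc n)"
      using tendsto_add[OF tendsto_const lim0, of "1 / real (Suc n)"] by simp
  qed (use diff in auto)
  have "(f has_vector_derivative D) (at t)"
    unfolding has_vector_derivative_def has_derivative_within_alt
  proof (intro conjI allI impI bounded_linear_scaleR_left)
    fix e :: real assume "e > 0"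
    then obtain n where n: "1 / real (Suc n) < e / 2"
      using LIMSEQ_D[OF lim0, of "e / 2"] by auto
    show "\<exists>d>0. \<forall>y\<in>UNIV. norm (y - t) < d \<longrightarrow> norm (f y - f t - (y - t) *\<^sub>R D) \<le> e * norm (y - t)"
    proof (intro exI conjI ballI impI)
      show "r n > 0" by fact
      fix y assume y: "norm (y - t) < r n"
      have "norm (f y - f t - (y - t) *\<^sub>R D)
          = norm ((f y - f t - (y - t) *\<^sub>R m n) + (y - t) *\<^sub>R (m n - D))"
        by (simp add: algebra_simps)
      also have "\<dots> \<le> 1 / real (Suc n) * \<bar>y - t\<bar> + \<bar>y - t\<bar> * (1 / real (Suc n))"
        using m[of y n] y mult_left_mono[OF mD[of n], of "\<bar>y - t\<bar>"]
        by (intro norm_triangle_mono) auto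
      also have "\<dots> = (2 * (1 / real (Suc n))) * \<bar>y - t\<bar>" by simp
      also have "\<dots> \<le> e * \<bar>y - t\<bar>"
        using n by (intro mult_right_mono) auto
      finally show "norm (f y - f t - (y - t) *\<^sub>R D) \<le> e * norm (y - t)" by simp
    qed
  qed
  then show ?thesis by blast
qed

theorem lipschitz_differentiable_ae:
  fixes f :: "real \<Rightarrow> 'a::{real_inner, complete_space}"
  assumes lip: "L-lipschitz_on {a..b} f"
  shows "negligible {t \<in> {a<..<b}. \<nexists>D. (f has_vector_derivative D) (at t)}"
proof (cases "a < b")
  case True
  \<comment> \<open>Clamping the argument to [a, b] extends \<open>f\<close> to the whole line with
    the same Lipschitz constant and leaves derivatives at interior points unchanged.\<close>
  define g where "g t = f (max a (min b t))" for t
  have "L-lipschitz_on UNIV g"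
  proof (rule lipschitz_onI)
    show "0 \<le> L" using lip by (rule lipschitz_on_nonneg)
    fix x y :: real
    have "dist (g x) (g y) \<le> L * dist (max a (min b x)) (max a (min b y))"
      unfolding g_def using True by (intro lipschitz_onD[OF lip]) auto
    also have "\<dots> \<le> L * dist x y"
      using \<open>0 \<le> L\<close> by (intro mult_left_mono) (auto simp: dist_real_def)
    finally show "dist (g x) (g y) \<le> L * dist x y" .
  qed
  then have neg: "negligible (\<Union>n. oscillating (1 / real (Suc n)) g \<inter> {a..b})"
    using negligible_oscillating[of L g] True by (intro negligible_countable_Union) auto
  show ?thesis
  proof (rule negligible_subset[OF neg], rule subsetI, rule ccontr)
    fix t assume t: "t \<in> {t \<in> {a<..<b}. \<nexists>D. (f has_vector_derivative D) (at t)}"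
      and no: "t \<notin> (\<Union>n. oscillating (1 / real (Suc n)) g \<inter> {a..b})"
    then obtain D where "(g has_vector_derivative D) (at t)"
      using has_vector_derivative_if_not_oscillating[of t g] by auto
    then have "(f has_vector_derivative D) (at t)"
      by (rule has_vector_derivative_transform_within_open[of _ _ _ "{a<..<b}"])
        (use t in \<open>auto simp: g_def\<close>)
    with t show False by blast
  qed
qed auto

subsection \<open>Minty's theorem and the Yosida regularization\<close>

text \<open>\<open>E\<close> plays the role of the epigraph of a closed convex function h. Strong
  convexity of h(z) + |z|^2 / 2 makes minimizing sequences Cauchy, which replaces weak compactness.
  The conclusion is first-order optimality: -z is a subgradient of h at the minimizer z.\<close>

lemma strongly_convex_minimum:
  fixes E :: "('b::{real_inner, complete_space} \<times> real) set"
  assumes "closed E" "convex E" "E \<noteq> {}"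
    and lower: "\<And>z r. (z, r) \<in> E \<Longrightarrow> B \<le> r + (norm z)\<^sup>2 / 2"
  obtains z r where "(z, r) \<in> E" "\<And>z' r'. (z', r') \<in> E \<Longrightarrow> 0 \<le> r' - r + z \<bullet> (z' - z)"
proof -
  define \<Psi> where "\<Psi> = (\<lambda>(z::'b, r). r + (norm z)\<^sup>2 / 2)"
  define m where "m = Inf (\<Psi> ` E)"
  have bdd: "bdd_below (\<Psi> ` E)" using lower by (auto simp: \<Psi>_def intro!: bdd_belowI)
  have m_le: "m \<le> \<Psi> p" if "p \<in> E" for p
    unfolding m_def using that bdd by (intro cInf_lower) auto
  have "\<exists>p\<in>E. \<Psi> p < m + 1 / real (Suc n)" for n
    using cInf_less_iff[of "\<Psi> ` E" "m + 1 / real (Suc n)"] bdd \<open>E \<noteq> {}\<close> by (simp add: m_def)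
  then obtain p where pE: "\<And>n. p n \<in> E" and p: "\<And>n. \<Psi> (p n) < m + 1 / real (Suc n)" by metis
  define z where "z n = fst (p n)" for n
  \<comment> \<open>The midpoint of two almost minimizing points lies in \<open>E\<close>; by the
    parallelogram law its value drops by |z n - z k|^2 / 8 below their average, yet not below
    \<open>m\<close>.\<close>
  have close: "(norm (z n - z k))\<^sup>2 \<le> 4 * (1 / real (Suc n) + 1 / real (Suc k))" for n k
  proof -
    have "(1/2) *\<^sub>R p n + (1/2) *\<^sub>R p k \<in> E"
      using \<open>convex E\<close> pE by (intro convexD) auto
    from m_le[OF this] have "m \<le> \<Psi> ((1/2) *\<^sub>R p n + (1/2) *\<^sub>R p k)" .
    also have "\<dots> = \<Psi> (p n) / 2 + \<Psi> (p k) / 2 - (norm (z n - z k))\<^sup>2 / 8"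
      unfolding \<Psi>_def z_def power2_norm_eq_inner
      by (simp add: case_prod_beta inner_add_left inner_add_right inner_diff_left inner_diff_right
          inner_commute field_simps)
    finally show ?thesis using p[of n] p[of k] by argo
  qed
  have lim0: "(\<lambda>n. 1 / real (Suc n)) \<longlonglongrightarrow> 0"
    using LIMSEQ_inverse_real_of_nat by (simp add: inverse_eq_divide)
  have "Cauchy z"
  proof (rule CauchyI)
    fix e :: real assume "e > 0"
    then have "e\<^sup>2 / 8 > 0" by simp
    then obtain N where N: "\<And>n. n \<ge> N \<Longrightarrow> 1 / real (Suc n) < e\<^sup>2 / 8"
      using LIMSEQ_D[OF lim0, of "e\<^sup>2 / 8"] by auto
    show "\<exists>M. \<forall>i\<ge>M. \<forall>n\<ge>M. norm (z i - z n) < e"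
    proof (intro exI allI impI)
      fix i n assume "N \<le> i" "N \<le> n"
      then have "(norm (z i - z n))\<^sup>2 < e\<^sup>2" using close[of i n] N[of i] N[of n] by argo
      then show "norm (z i - z n) < e" using \<open>e > 0\<close> by (simp add: power_less_imp_less_base)
    qed
  qed
  then obtain w where w: "z \<longlonglongrightarrow> w" using Cauchy_convergent convergent_def by blast
  have "(\<lambda>n. \<Psi> (p n)) \<longlonglongrightarrow> m"
  proof (rule tendsto_sandwich[OF _ _ tendsto_const])
    show "(\<lambda>n. m + 1 / real (Suc n)) \<longlonglongrightarrow> m"
      using tendsto_add[OF tendsto_const lim0, of m] by simp
  qed (use m_le pE p in \<open>auto intro!: always_eventually less_imp_le\<close>)
  then have "(\<lambda>n. \<Psi> (p n) - (norm (z n))\<^sup>2 / 2) \<longlonglongrightarrow> m - (norm w)\<^sup>2 / 2"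
    by (intro tendsto_intros w) auto
  moreover have "\<Psi> (p n) - (norm (z n))\<^sup>2 / 2 = snd (p n)" for n
    by (simp add: \<Psi>_def z_def case_prod_beta)
  ultimately have "(\<lambda>n. snd (p n)) \<longlonglongrightarrow> m - (norm w)\<^sup>2 / 2" by simp
  then have "(\<lambda>n. (z n, snd (p n))) \<longlonglongrightarrow> (w, m - (norm w)\<^sup>2 / 2)"
    by (intro tendsto_Pair w)
  then have "p \<longlonglongrightarrow> (w, m - (norm w)\<^sup>2 / 2)" by (simp add: z_def)
  then have wE: "(w, m - (norm w)\<^sup>2 / 2) \<in> E"
    using \<open>closed E\<close> pE closed_sequentially by blast
  define r where "r = m - (norm w)\<^sup>2 / 2"
  show thesis
  proof (rule that)
    show "(w, r) \<in> E" using wE by (simp add: r_def)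
    fix z' r' assume E': "(z', r') \<in> E"
    define D where "D = r' - r + w \<bullet> (z' - w)"
    define N where "N = (norm (z' - w))\<^sup>2"
    \<comment> \<open>The minimizer is compared with points on the segment towards (z', r'), and the
      gain is divided by \<open>t\<close>.\<close>
    have ineq: "0 \<le> D + t / 2 * N" if "0 < t" "t \<le> 1" for t
    proof -
      have "(1 - t) *\<^sub>R (w, r) + t *\<^sub>R (z', r') \<in> E"
        using \<open>convex E\<close> wE E' that by (intro convexD) (auto simp: r_def)
      from m_le[OF this] have "m \<le> \<Psi> ((1 - t) *\<^sub>R (w, r) + t *\<^sub>R (z', r'))" .
      also have "\<dots> = m + t * (D + t / 2 * N)"
        unfolding \<Psi>_def D_def N_def r_def power2_norm_eq_inner
        by (simp add: inner_add_left inner_add_right inner_diff_left inner_diff_right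
            inner_commute field_simps)
      finally show ?thesis using that by (simp add: zero_le_mult_iff)
    qed
    show "0 \<le> r' - r + w \<bullet> (z' - w)"
    proof (rule ccontr)
      assume "\<not> ?thesis"
      then have "D < 0" by (simp add: D_def)
      have "N \<ge> 0" by (simp add: N_def)
      \<comment> \<open>Chosen so that t N \<le> -D, whence D + t N / 2 \<le> D / 2 < 0.\<close>
      define t where "t = min 1 (- D / (N + 1))"
      have "t > 0" "t \<le> 1" using \<open>D < 0\<close> \<open>N \<ge> 0\<close> by (auto simp: t_def divide_neg_pos)
      have "t * N \<le> t * (N + 1)" using \<open>t > 0\<close> by simp
      also have "\<dots> \<le> - D / (N + 1) * (N + 1)"
        using \<open>N \<ge> 0\<close> by (intro mult_right_mono) (auto simp: t_def)
      also have "\<dots> = - D" using \<open>N \<ge> 0\<close> by simp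
      finally show False using ineq[OF \<open>t > 0\<close> \<open>t \<le> 1\<close>] \<open>D < 0\<close> by simp
    qed
  qed
qed

text \<open>Simons and Zalinescu's proof: \<open>E\<close> below is the epigraph of the Fitzpatrick function of \<open>G\<close>, and the
  optimality condition at the minimizer of this function plus half the squared norm yields \<open>u\<close>.\<close>

lemma minty:
  fixes G :: "('a::{real_inner, complete_space} \<times> 'a) set"
  assumes mono: "\<And>v c v' c'. (v, c) \<in> G \<Longrightarrow> (v', c') \<in> G \<Longrightarrow> 0 \<le> (v - v') \<bullet> (c - c')"
    and maximal: "\<And>u w. (\<And>v c. (v, c) \<in> G \<Longrightarrow> 0 \<le> (u - v) \<bullet> (w - c)) \<Longrightarrow> (u, w) \<in> G"
  shows "\<exists>u. (u, - u) \<in> G"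
proof -
  have "G \<noteq> {}" using maximal[of 0 0] by auto
  define E where "E = (\<Inter>(v, c)\<in>G. {(z, r). fst z \<bullet> c + v \<bullet> snd z - v \<bullet> c \<le> r})"
  \<comment> \<open>The Fitzpatrick function dominates the duality product: on \<open>G\<close> by
    testing with the point itself, elsewhere because maximality supplies a pair of \<open>G\<close>
    that violates monotonicity with \<open>z\<close>.\<close>
  have lower: "fst z \<bullet> snd z \<le> r" if "(z, r) \<in> E" for z r
  proof (cases "z \<in> G")
    case True
    then have "fst z \<bullet> snd z + fst z \<bullet> snd z - fst z \<bullet> snd z \<le> r"
      using that by (force simp: E_def)
    then show ?thesis by simp
  next
    case False
    then obtain v c where vc: "(v, c) \<in> G" "(fst z - v) \<bullet> (snd z - c) < 0"
      using maximal[of "fst z" "snd z"] by (metis not_le prod.collapse)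
    then have "fst z \<bullet> c + v \<bullet> snd z - v \<bullet> c \<le> r" using that by (force simp: E_def)
    then show ?thesis using vc(2) by (simp add: inner_diff_left inner_diff_right)
  qed
  have GE: "((v, c), v \<bullet> c) \<in> E" if "(v, c) \<in> G" for v c
  proof -
    have "v \<bullet> c' + v' \<bullet> c - v' \<bullet> c' \<le> v \<bullet> c" if "(v', c') \<in> G" for v' c'
      using mono[OF \<open>(v, c) \<in> G\<close> that] by (simp add: inner_diff_left inner_diff_right)
    then show ?thesis by (auto simp: E_def)
  qed
  have E_halfspaces: "E = (\<Inter>(v, c)\<in>G. {p. ((c, v), - 1) \<bullet> p \<le> v \<bullet> c})"
    by (auto simp: E_def inner_prod_def inner_commute algebra_simps)
  have "closed E"
    unfolding E_halfspaces by (auto intro: closed_halfspace_le)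
  moreover have "convex E"
    unfolding E_halfspaces by (auto intro!: convex_INT convex_halfspace_le)
  moreover have "E \<noteq> {}" using \<open>G \<noteq> {}\<close> GE by force
  moreover have "0 \<le> r + (norm z)\<^sup>2 / 2" if "(z, r) \<in> E" for z r
  proof -
    have "0 \<le> (fst z + snd z) \<bullet> (fst z + snd z)" by simp
    also have "\<dots> = 2 * (fst z \<bullet> snd z) + (norm z)\<^sup>2"
      by (simp add: power2_norm_eq_inner inner_add_left inner_add_right inner_commute inner_prod_def)
    finally show ?thesis using lower[OF that] by simp
  qed
  ultimately obtain z r where zr: "(z, r) \<in> E"
    "\<And>z' r'. (z', r') \<in> E \<Longrightarrow> 0 \<le> r' - r + z \<bullet> (z' - z)"
    using strongly_convex_minimum[of E 0] by metis
  obtain u w where z: "z = (u, w)" by force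
  \<comment> \<open>Optimality is tested at the points of the epigraph above \<open>G\<close>. With
    u \<bullet> w \<le> r, the terms combine into the monotonicity product of (-w, -u) and (v, c)
    minus |u + w|^2.\<close>
  have key: "(norm (u + w))\<^sup>2 \<le> (- w - v) \<bullet> (- u - c)" if "(v, c) \<in> G" for v c
  proof -
    have "0 \<le> v \<bullet> c - r + u \<bullet> (v - u) + w \<bullet> (c - w)"
      using zr(2)[OF GE[OF that]] by (simp add: z inner_prod_def)
    moreover have "u \<bullet> w \<le> r" using lower[OF zr(1)] by (simp add: z)
    ultimately show ?thesis
      by (simp add: power2_norm_eq_inner inner_add_left inner_add_right
          inner_diff_left inner_diff_right inner_commute)
  qed
  \<comment> \<open>The point is monotonically related to all of \<open>G\<close> and hence belongs
    to it; inserting it into its own estimate makes the right-hand side 0.\<close>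
  have in_G: "(- w, - u) \<in> G" using key by (intro maximal) (meson order_trans zero_le_power2)
  then have "u + w = 0" using key[OF in_G] by simp
  then have "w = - u" by (simp add: add_eq_0_iff)
  with in_G show ?thesis by auto
qed

section \<open>The Yosida regularization as a Lipschitz map\<close>

lemma maximally_comonotoneD:
  assumes "maximally_comonotone \<rho> A"
    and rel: "\<And>y v. v \<in> A y \<Longrightarrow> \<rho> * (norm (u - v))\<^sup>2 \<le> (x - y) \<bullet> (u - v)"
  shows "u \<in> A x"
proof (rule ccontr)
  assume u: "u \<notin> A x"
  \<comment> \<open>Adjoining the pair (x, u) to the graph keeps comonotonicity and would properly
    extend a maximal graph.\<close>
  define B where "B = A(x := insert u (A x))"
  have gra: "gra B = insert (x, u) (gra A)" by (auto simp: gra_def B_def split: if_splits)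
  have "\<rho> * (norm (v - u))\<^sup>2 \<le> (y - x) \<bullet> (v - u)" if "v \<in> A y" for y v
    using rel[OF that] by (simp add: norm_minus_commute inner_diff_left inner_diff_right)
  then have "comonotone \<rho> B"
    using assms unfolding maximally_comonotone_def comonotone_def gra by (auto simp: gra_def)
  moreover have "(x, u) \<notin> gra A" using u by (simp add: gra_def)
  then have "gra A \<subset> gra B" unfolding gra by blast
  ultimately show False using assms(1) unfolding maximally_comonotone_def by blast
qed

text \<open>Comonotonicity of \<open>A\<close> says that the inverse of \<open>A\<close> minus
  \<rho> Id is monotone. \<open>G\<close> is the graph of this operator, shifted by \<open>x\<close>
  and scaled by 1/\<kappa>, which preserves maximality. A pair (u, -u) in it means y = x + \<rho> u
  - \<kappa> u, and this is x - \<eta> u for \<kappa> = \<eta> + \<rho>.\<close>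

lemma exists_yosida:
  fixes A :: "'a::{real_inner, complete_space} \<Rightarrow> 'a set"
  assumes A: "maximally_comonotone \<rho> A" and "\<eta> + \<rho> > 0"
  shows "\<exists>u. u \<in> A (x - \<eta> *\<^sub>R u)"
proof -
  define \<kappa> where "\<kappa> = \<eta> + \<rho>"
  have "\<kappa> > 0" using assms by (simp add: \<kappa>_def)
  define G where "G = {(v, (1 / \<kappa>) *\<^sub>R (y - \<rho> *\<^sub>R v - x)) | y v. v \<in> A y}"
  have "\<exists>u. (u, - u) \<in> G"
  proof (rule minty)
    fix v c v' c' assume "(v, c) \<in> G" "(v', c') \<in> G"
    then obtain y y' where y: "v \<in> A y" "c = (1 / \<kappa>) *\<^sub>R (y - \<rho> *\<^sub>R v - x)"
      "v' \<in> A y'" "c' = (1 / \<kappa>) *\<^sub>R (y' - \<rho> *\<^sub>R v' - x)" by (auto simp: G_def)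
    then have "\<rho> * (norm (v - v'))\<^sup>2 \<le> (y - y') \<bullet> (v - v')"
      using A by (auto simp: maximally_comonotone_def comonotone_def gra_def)
    moreover have "c - c' = (1 / \<kappa>) *\<^sub>R (y - y' - \<rho> *\<^sub>R (v - v'))"
      by (simp add: y algebra_simps)
    ultimately show "0 \<le> (v - v') \<bullet> (c - c')"
      using \<open>\<kappa> > 0\<close> by (simp add: power2_norm_eq_inner inner_diff_right[of _ "y - y'"] inner_commute)
  next
    fix u w assume rel: "\<And>v c. (v, c) \<in> G \<Longrightarrow> 0 \<le> (u - v) \<bullet> (w - c)"
    define y where "y = \<kappa> *\<^sub>R w + x + \<rho> *\<^sub>R u"
    have "u \<in> A y"
    proof (rule maximally_comonotoneD[OF A])
      fix y' v assume "v \<in> A y'"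
      then have "0 \<le> (u - v) \<bullet> (w - (1 / \<kappa>) *\<^sub>R (y' - \<rho> *\<^sub>R v - x))"
        by (intro rel) (auto simp: G_def)
      also have "w - (1 / \<kappa>) *\<^sub>R (y' - \<rho> *\<^sub>R v - x) = (1 / \<kappa>) *\<^sub>R (y - y' - \<rho> *\<^sub>R (u - v))"
        using \<open>\<kappa> > 0\<close> by (simp add: y_def algebra_simps)
      finally have "0 \<le> (u - v) \<bullet> (y - y' - \<rho> *\<^sub>R (u - v))"
        using \<open>\<kappa> > 0\<close> by (simp add: zero_le_divide_iff)
      then show "\<rho> * (norm (u - v))\<^sup>2 \<le> (y - y') \<bullet> (u - v)"
        by (simp add: power2_norm_eq_inner inner_diff_right[of _ "y - y'"] inner_commute)
    qed
    moreover have "w = (1 / \<kappa>) *\<^sub>R (y - \<rho> *\<^sub>R u - x)"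
      using \<open>\<kappa> > 0\<close> by (simp add: y_def)
    ultimately show "(u, w) \<in> G" by (auto simp: G_def)
  qed
  then obtain u y where u: "u \<in> A y" "- u = (1 / \<kappa>) *\<^sub>R (y - \<rho> *\<^sub>R u - x)" by (auto simp: G_def)
  then have "\<kappa> *\<^sub>R (- u) = y - \<rho> *\<^sub>R u - x" using \<open>\<kappa> > 0\<close> by simp
  then have "y = x - \<eta> *\<^sub>R u" by (simp add: \<kappa>_def algebra_simps)
  with u show ?thesis by blast
qed

lemma yosida_set_eq:
  assumes "\<eta> \<noteq> 0"
  shows "yosida_set \<eta> A x = {u. u \<in> A (x - \<eta> *\<^sub>R u)}"
proof (intro set_eqI iffI)
  fix u assume "u \<in> yosida_set \<eta> A x"
  then obtain p v where "v \<in> A p" "x = p + \<eta> *\<^sub>R v" "u = (1 / \<eta>) *\<^sub>R (x - p)"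
    by (auto simp: yosida_set_def resolvent_def op_inverse_def)
  then show "u \<in> {u. u \<in> A (x - \<eta> *\<^sub>R u)}" using assms by simp
next
  fix u assume "u \<in> {u. u \<in> A (x - \<eta> *\<^sub>R u)}"
  then have "x - \<eta> *\<^sub>R u \<in> resolvent \<eta> A x" by (auto simp: resolvent_def op_inverse_def)
  moreover have "u = (1 / \<eta>) *\<^sub>R (x - (x - \<eta> *\<^sub>R u))" using assms by simp
  ultimately show "u \<in> yosida_set \<eta> A x" unfolding yosida_set_def by blast
qed

text \<open>Comonotonicity at x - \<eta> u and x' - \<eta> u' yields (\<eta> + \<rho>) |u - u'|^2
  \<le> (x - x') \<bullet> (u - u'). Cauchy-Schwarz gives the Lipschitz bound; the case x = x' shows
  that \<open>yosida_set\<close> is a singleton, so \<open>the_elem\<close> is meaningful.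
  Positivity of \<eta> + \<rho> follows from \<rho> > -\<eta> / 2.\<close>

lemma yosida_lipschitz:
  fixes A :: "'a::{real_inner, complete_space} \<Rightarrow> 'a set"
  assumes A: "maximally_comonotone \<rho> A" and "\<eta> > max (- 2 * \<rho>) 0"
  shows "(1 / (\<eta> + \<rho>))-lipschitz_on UNIV (yosida \<eta> A)"
proof -
  have pos: "\<eta> > 0" "\<eta> + \<rho> > 0" using assms by auto
  have le: "norm (u - u') \<le> 1 / (\<eta> + \<rho>) * norm (x - x')"
    if "u \<in> A (x - \<eta> *\<^sub>R u)" "u' \<in> A (x' - \<eta> *\<^sub>R u')" for u u' x x'
  proof -
    have "\<rho> * (norm (u - u'))\<^sup>2 \<le> (x - \<eta> *\<^sub>R u - (x' - \<eta> *\<^sub>R u')) \<bullet> (u - u')"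
      using A that by (auto simp: maximally_comonotone_def comonotone_def gra_def)
    also have "x - \<eta> *\<^sub>R u - (x' - \<eta> *\<^sub>R u') = (x - x') - \<eta> *\<^sub>R (u - u')" by (simp add: algebra_simps)
    also have "\<dots> \<bullet> (u - u') = (x - x') \<bullet> (u - u') - \<eta> * (norm (u - u'))\<^sup>2"
      by (simp add: inner_diff_left[of "x - x'"] power2_norm_eq_inner)
    finally have "(\<eta> + \<rho>) * (norm (u - u'))\<^sup>2 \<le> (x - x') \<bullet> (u - u')" by (simp add: algebra_simps)
    also have "\<dots> \<le> norm (x - x') * norm (u - u')" by (rule norm_cauchy_schwarz)
    finally have "(\<eta> + \<rho>) * norm (u - u') * norm (u - u') \<le> norm (x - x') * norm (u - u')"
      by (simp add: power2_eq_square mult.assoc)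
    then have "(\<eta> + \<rho>) * norm (u - u') \<le> norm (x - x')"
      by (cases "u = u'") (auto simp: mult_le_cancel_right)
    then show ?thesis using pos by (simp add: field_simps)
  qed
  have yosida: "yosida \<eta> A x \<in> A (x - \<eta> *\<^sub>R yosida \<eta> A x)" for x
  proof -
    obtain u where u: "u \<in> A (x - \<eta> *\<^sub>R u)" using exists_yosida[OF A pos(2)] by blast
    have "v = u" if "v \<in> A (x - \<eta> *\<^sub>R v)" for v
      using le[OF that u] by simp
    then have "yosida_set \<eta> A x = {u}"
      using u pos yosida_set_eq[of \<eta> A x] by blast
    then show ?thesis using u by (simp add: yosida_def)
  qed
  show ?thesis
    using pos le[OF yosida yosida] by (intro lipschitz_onI) (auto simp: dist_norm)
qed

subsection \<open>Absolutely continuous functions\<close>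

lemma absolutely_continuous_on_intervalE:
  assumes "absolutely_continuous_on_interval a b f" "e > 0"
  obtains d where "d > 0" "\<And>I. finite I \<Longrightarrow> (\<And>r s. (r, s) \<in> I \<Longrightarrow> a \<le> r \<and> r \<le> s \<and> s \<le> b) \<Longrightarrow>
    disjoint_family_on (\<lambda>(r, s). {r<..<s}) I \<Longrightarrow> (\<Sum>(r, s)\<in>I. s - r) < d
    \<Longrightarrow> (\<Sum>(r, s)\<in>I. norm (f s - f r)) < e"
proof -
  obtain d where "d > 0" and d: "\<forall>I. finite I \<and> (\<forall>(r, s)\<in>I. a \<le> r \<and> r \<le> s \<and> s \<le> b) \<and>
      disjoint_family_on (\<lambda>(r, s). {r<..<s}) I \<and> (\<Sum>(r, s)\<in>I. s - r) < d
      \<longrightarrow> (\<Sum>(r, s)\<in>I. norm (f s - f r)) < e"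
    using mp[OF spec[OF assms(1)[unfolded absolutely_continuous_on_interval_def], of e] assms(2)]
    by (elim exE conjE) (rule that)
  show thesis
  proof (rule that[OF \<open>d > 0\<close>])
    fix I assume *: "finite I" "\<And>r s. (r, s) \<in> I \<Longrightarrow> a \<le> r \<and> r \<le> s \<and> s \<le> b"
      "disjoint_family_on (\<lambda>(r, s). {r<..<s}) I" "(\<Sum>(r, s)\<in>I. s - r) < d"
    have "\<forall>(r, s)\<in>I. a \<le> r \<and> r \<le> s \<and> s \<le> b" using *(2) by blast
    with * show "(\<Sum>(r, s)\<in>I. norm (f s - f r)) < e" by (intro d[rule_format] conjI)
  qed
qed

lemma absolutely_continuous_on_interval_add:
  assumes "absolutely_continuous_on_interval a b f" "absolutely_continuous_on_interval a b g"
  shows "absolutely_continuous_on_interval a b (\<lambda>t. f t + g t)"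
  unfolding absolutely_continuous_on_interval_def
proof (intro allI impI)
  fix e :: real assume "e > 0"
  then have "e / 2 > 0" by simp
  obtain d1 where "d1 > 0" and d1: "\<And>I. finite I \<Longrightarrow> (\<And>r s. (r, s) \<in> I \<Longrightarrow> a \<le> r \<and> r \<le> s \<and> s \<le> b) \<Longrightarrow>
      disjoint_family_on (\<lambda>(r, s). {r<..<s}) I \<Longrightarrow> (\<Sum>(r, s)\<in>I. s - r) < d1
      \<Longrightarrow> (\<Sum>(r, s)\<in>I. norm (f s - f r)) < e / 2"
    using absolutely_continuous_on_intervalE[OF assms(1) \<open>e / 2 > 0\<close>] by metis
  obtain d2 where "d2 > 0" and d2: "\<And>I. finite I \<Longrightarrow> (\<And>r s. (r, s) \<in> I \<Longrightarrow> a \<le> r \<and> r \<le> s \<and> s \<le> b) \<Longrightarrow>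
      disjoint_family_on (\<lambda>(r, s). {r<..<s}) I \<Longrightarrow> (\<Sum>(r, s)\<in>I. s - r) < d2
      \<Longrightarrow> (\<Sum>(r, s)\<in>I. norm (g s - g r)) < e / 2"
    using absolutely_continuous_on_intervalE[OF assms(2) \<open>e / 2 > 0\<close>] by metis
  show "\<exists>d>0. \<forall>I. finite I \<and> (\<forall>(r, s)\<in>I. a \<le> r \<and> r \<le> s \<and> s \<le> b) \<and>
      disjoint_family_on (\<lambda>(r, s). {r<..<s}) I \<and> (\<Sum>(r, s)\<in>I. s - r) < d
      \<longrightarrow> (\<Sum>(r, s)\<in>I. norm (f s + g s - (f r + g r))) < e"
  proof (intro exI[of _ "min d1 d2"] conjI allI impI)
    fix I assume I: "finite I \<and> (\<forall>(r, s)\<in>I. a \<le> r \<and> r \<le> s \<and> s \<le> b) \<and>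
      disjoint_family_on (\<lambda>(r, s). {r<..<s}) I \<and> (\<Sum>(r, s)\<in>I. s - r) < min d1 d2"
    have "norm (f s + g s - (f r + g r)) \<le> norm (f s - f r) + norm (g s - g r)" for r s
      unfolding add_diff_add by (rule norm_triangle_ineq)
    then have "(\<Sum>(r, s)\<in>I. norm (f s + g s - (f r + g r)))
        \<le> (\<Sum>(r, s)\<in>I. norm (f s - f r) + norm (g s - g r))"
      unfolding case_prod_beta by (rule sum_mono)
    also have "\<dots> = (\<Sum>(r, s)\<in>I. norm (f s - f r)) + (\<Sum>(r, s)\<in>I. norm (g s - g r))"
      unfolding case_prod_beta by (rule sum.distrib)
    also have "\<dots> < e / 2 + e / 2"
      using I by (intro add_strict_mono d1 d2) auto
    finally show "(\<Sum>(r, s)\<in>I. norm (f s + g s - (f r + g r))) < e" by simp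
  qed (use \<open>d1 > 0\<close> \<open>d2 > 0\<close> in auto)
qed

lemma lipschitz_imp_absolutely_continuous:
  assumes "L-lipschitz_on {a..b} f"
  shows "absolutely_continuous_on_interval a b f"
  unfolding absolutely_continuous_on_interval_def
proof (intro allI impI)
  fix e :: real assume "e > 0"
  have "L \<ge> 0" using assms by (rule lipschitz_on_nonneg)
  show "\<exists>d>0. \<forall>I. finite I \<and> (\<forall>(r, s)\<in>I. a \<le> r \<and> r \<le> s \<and> s \<le> b) \<and>
      disjoint_family_on (\<lambda>(r, s). {r<..<s}) I \<and> (\<Sum>(r, s)\<in>I. s - r) < d
      \<longrightarrow> (\<Sum>(r, s)\<in>I. norm (f s - f r)) < e"
  proof (intro exI[of _ "e / (L + 1)"] conjI allI impI)
    fix I assume I: "finite I \<and> (\<forall>(r, s)\<in>I. a \<le> r \<and> r \<le> s \<and> s \<le> b) \<and>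
      disjoint_family_on (\<lambda>(r, s). {r<..<s}) I \<and> (\<Sum>(r, s)\<in>I. s - r) < e / (L + 1)"
    have "(\<Sum>(r, s)\<in>I. norm (f s - f r)) \<le> (\<Sum>(r, s)\<in>I. (L + 1) * (s - r))"
    proof (intro sum_mono, clarify)
      fix r s assume "(r, s) \<in> I"
      then have rs: "a \<le> r" "r \<le> s" "s \<le> b" using I by blast+
      then have "norm (f s - f r) \<le> L * (s - r)"
        using lipschitz_on_normD[OF assms, of s r] by auto
      then show "norm (f s - f r) \<le> (L + 1) * (s - r)" using rs by (simp add: algebra_simps)
    qed
    also have "\<dots> = (L + 1) * (\<Sum>(r, s)\<in>I. s - r)"
      by (simp add: sum_distrib_left case_prod_beta)
    also have "\<dots> < e" using I \<open>L \<ge> 0\<close> by (simp add: field_simps)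
    finally show "(\<Sum>(r, s)\<in>I. norm (f s - f r)) < e" .
  qed (use \<open>e > 0\<close> \<open>L \<ge> 0\<close> in auto)
qed

text \<open>A gauge argument, valid in any normed space: cells tagged outside \<open>N\<close>
  contribute little because the derivative vanishes at the tag, and cells tagged in \<open>N\<close>
  contribute little by absolute continuity, since they lie in an open set of small measure.\<close>

lemma absolutely_continuous_zero_derivative:
  fixes f :: "real \<Rightarrow> 'a::real_normed_vector"
  assumes ac: "absolutely_continuous_on_interval a b f" and "a \<le> b" and N: "negligible N"
    and deriv: "\<And>t. t \<in> {a..b} - N \<Longrightarrow> (f has_vector_derivative 0) (at t within {a..b})"
  shows "f b = f a"
proof -
  have bound: "norm (f b - f a) \<le> e + e * (b - a)" if "e > 0" for e
  proof -
    obtain d where "d > 0" and d: "\<And>I. finite I \<Longrightarrow> (\<And>r s. (r, s) \<in> I \<Longrightarrow> a \<le> r \<and> r \<le> s \<and> s \<le> b) \<Longrightarrow>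
        disjoint_family_on (\<lambda>(r, s). {r<..<s}) I \<Longrightarrow> (\<Sum>(r, s)\<in>I. s - r) < d
        \<Longrightarrow> (\<Sum>(r, s)\<in>I. norm (f s - f r)) < e"
      using absolutely_continuous_on_intervalE[OF ac \<open>e > 0\<close>] by metis
    obtain U where U: "open U" "N \<subseteq> U" "U - N \<in> lmeasurable" "emeasure lebesgue (U - N) < ennreal d"
      using sets_lebesgue_outer_open[OF negligible_imp_sets[OF N] \<open>d > 0\<close>] by metis
    have "U = (U - N) \<union> N" using U(2) by blast
    then have Um: "U \<in> lmeasurable"
      using fmeasurable.Un[OF U(3) negligible_imp_measurable[OF N]] by simp
    have "measure lebesgue U = measure lebesgue ((U - N) \<union> N)" using U(2) by (simp add: Un_absorb2)
    also have "\<dots> = measure lebesgue (U - N)"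
      using U(3) N by (intro measure_Un_null_set) (auto simp: negligible_iff_null_sets fmeasurableD)
    also have "\<dots> < d"
      using U(3,4) \<open>d > 0\<close> by (simp add: emeasure_eq_measure2 ennreal_less_iff)
    finally have Ud: "measure lebesgue U < d" .
    \<comment> \<open>The gauge: around points of \<open>N\<close> it stays inside \<open>U\<close>,
      around other points of [a, b] it keeps increments of \<open>f\<close> below \<open>e\<close>
      times the distance.\<close>
    have "\<exists>r>0. (t \<in> N \<longrightarrow> ball t r \<subseteq> U) \<and>
       (t \<in> {a..b} - N \<longrightarrow> (\<forall>s\<in>{a..b}. \<bar>s - t\<bar> < r \<longrightarrow> norm (f s - f t) \<le> e * \<bar>s - t\<bar>))" for t
    proof (cases "t \<in> N")
      case True
      then show ?thesis using U openE by (metis DiffE subsetD)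
    next
      case False
      show ?thesis
      proof (cases "t \<in> {a..b}")
        case True
        with False deriv have "(f has_vector_derivative 0) (at t within {a..b})" by simp
        then show ?thesis using False \<open>e > 0\<close>
          unfolding has_vector_derivative_def has_derivative_within_alt by auto
      qed (use False in \<open>auto intro: exI[of _ 1]\<close>)
    qed
    then obtain rad where rad: "\<And>t. rad t > 0" "\<And>t. t \<in> N \<Longrightarrow> ball t (rad t) \<subseteq> U"
      "\<And>t s. t \<in> {a..b} - N \<Longrightarrow> s \<in> {a..b} \<Longrightarrow> \<bar>s - t\<bar> < rad t \<Longrightarrow> norm (f s - f t) \<le> e * \<bar>s - t\<bar>"
      by metis
    obtain p where p: "p tagged_division_of {a..b}" "(\<lambda>t. ball t (rad t)) fine p"
      using fine_division_exists_real[of "\<lambda>t. ball t (rad t)" a b] rad(1) by (auto simp: gauge_def)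
    note pD = tagged_division_ofD[OF p(1)]
    have K: "K = {Inf K..Sup K}" "Inf K \<le> x" "x \<le> Sup K" "a \<le> Inf K" "Sup K \<le> b"
        "K \<subseteq> ball x (rad x)" if xK: "(x, K) \<in> p" for x K
    proof -
      obtain c d where "K = {c..d}" using pD(4)[OF xK] by (metis box_real(2))
      then show "K = {Inf K..Sup K}" "Inf K \<le> x" "x \<le> Sup K" "a \<le> Inf K" "Sup K \<le> b"
        "K \<subseteq> ball x (rad x)"
        using pD(2)[OF xK] pD(3)[OF xK] fineD[OF p(2) xK] by auto
    qed
    \<comment> \<open>Degenerate cells have zero increment and are left out. The remaining ones have
      nonempty interiors, so distinct members have distinct endpoints and \<open>ends\<close> is
      injective.\<close>
    define p1 where "p1 = {(x, K) \<in> p. x \<in> N \<and> Inf K < Sup K}"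
    define ends :: "real \<times> real set \<Rightarrow> real \<times> real" where "ends = (\<lambda>(x, K). (Inf K, Sup K))"
    let ?I = "ends ` p1"
    have "p1 \<subseteq> p" by (auto simp: p1_def)
    then have fin: "finite p1" using pD(1) finite_subset by blast
    have disj: "{Inf K<..<Sup K} \<inter> {Inf K'<..<Sup K'} = {}"
      if "(x, K) \<in> p" "(x', K') \<in> p" "(x, K) \<noteq> (x', K')" for x K x' K'
    proof -
      have "interior K \<inter> interior K' = {}" using pD(5) that by blast
      then show ?thesis using K(1)[OF that(1)] K(1)[OF that(2)] by (metis interior_atLeastAtMost_real)
    qed
    have inj: "inj_on ends p1"
    proof (rule inj_onI, clarify)
      fix x K x' K' assume *: "(x, K) \<in> p1" "(x', K') \<in> p1" "ends (x, K) = ends (x', K')"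
      show "x = x' \<and> K = K'"
      proof (rule ccontr)
        assume "\<not> ?thesis"
        then have "{Inf K<..<Sup K} \<inter> {Inf K'<..<Sup K'} = {}"
          using * by (intro disj[of x K x' K']) (auto simp: p1_def)
        moreover have "Inf K < Sup K" "Inf K = Inf K'" "Sup K = Sup K'"
          using * by (auto simp: p1_def ends_def)
        ultimately show False by simp
      qed
    qed
    have disjI: "disjoint_family_on (\<lambda>(r, s). {r<..<s}) ?I"
      unfolding disjoint_family_on_def
    proof (intro ballI impI)
      fix i j assume "i \<in> ?I" "j \<in> ?I" "i \<noteq> j"
      then obtain x K x' K' where *: "(x, K) \<in> p1" "(x', K') \<in> p1" "i = (Inf K, Sup K)" "j = (Inf K', Sup K')"
        by (auto simp: ends_def)
      then show "(case i of (r, s) \<Rightarrow> {r<..<s}) \<inter> (case j of (r, s) \<Rightarrow> {r<..<s}) = {}"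
        using disj[of x K x' K'] \<open>i \<noteq> j\<close> \<open>p1 \<subseteq> p\<close> by auto
    qed
    have I: "a \<le> r" "r < s" "s \<le> b" "{r<..<s} \<subseteq> U" if rs: "(r, s) \<in> ?I" for r s
    proof -
      from rs obtain x K' where *: "(x, K') \<in> p" "x \<in> N" "r = Inf K'" "s = Sup K'" "r < s"
        by (auto simp: ends_def p1_def)
      then show "a \<le> r" "r < s" "s \<le> b" using K[OF *(1)] by auto
      have "{r<..<s} \<subseteq> {r..s}" by auto
      also have "\<dots> \<subseteq> ball x (rad x)" using K(1,6)[OF *(1)] * by metis
      finally show "{r<..<s} \<subseteq> U" using rad(2)[OF \<open>x \<in> N\<close>] by simp
    qed
    have "(\<Sum>(r, s)\<in>?I. s - r) = (\<Sum>i\<in>?I. measure lebesgue (case i of (r, s) \<Rightarrow> {r<..<s}))"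
      using I(2) by (intro sum.cong) (auto simp: less_imp_le)
    also have "\<dots> = measure lebesgue (\<Union>i\<in>?I. case i of (r, s) \<Rightarrow> {r<..<s})"
      using fin disjI I(2) by (intro measure_finite_Union[symmetric]) (auto simp: less_imp_le)
    also have "\<dots> \<le> measure lebesgue U"
    proof (rule measure_mono_fmeasurable)
      show "(\<Union>i\<in>?I. case i of (r, s) \<Rightarrow> {r<..<s}) \<subseteq> U"
        using I(4) by (intro UN_least) (simp only: split_paired_all case_prod_conv)
      show "(\<Union>i\<in>?I. case i of (r, s) \<Rightarrow> {r<..<s}) \<in> sets lebesgue"
        using fin by (intro sets.finite_UN) (auto split: prod.splits)
    qed (rule Um)
    finally have "(\<Sum>(r, s)\<in>?I. s - r) < d" using Ud by simp
    then have "(\<Sum>(r, s)\<in>?I. norm (f s - f r)) < e"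
      using fin disjI I by (intro d) (auto simp: less_imp_le)
    moreover have "(\<Sum>(r, s)\<in>?I. norm (f s - f r)) = (\<Sum>(x, K)\<in>p1. norm (f (Sup K) - f (Inf K)))"
      by (subst sum.reindex[OF inj]) (simp add: ends_def case_prod_beta o_def)
    ultimately have big: "(\<Sum>(x, K)\<in>p1. norm (f (Sup K) - f (Inf K))) < e" by simp
    have "(\<Sum>(x, K)\<in>p - p1. norm (f (Sup K) - f (Inf K))) \<le> (\<Sum>(x, K)\<in>p - p1. e * (Sup K - Inf K))"
    proof (intro sum_mono, clarify)
      fix x K assume xK: "(x, K) \<in> p" "(x, K) \<notin> p1"
      note K' = K[OF xK(1)]
      show "norm (f (Sup K) - f (Inf K)) \<le> e * (Sup K - Inf K)"
      proof (cases "x \<in> N")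
        case True
        then have "Sup K = Inf K" using xK K' by (auto simp: p1_def)
        then show ?thesis by simp
      next
        case False
        then have x: "x \<in> {a..b} - N" using K' by auto
        have "Inf K \<in> K" "Sup K \<in> K" using K' by (metis atLeastAtMost_iff order_refl order_trans)+
        then have close: "\<bar>Inf K - x\<bar> < rad x" "\<bar>Sup K - x\<bar> < rad x"
          using K'(6) by (auto simp: dist_real_def abs_minus_commute)
        \<comment> \<open>The increment is split at the tag, the only point where the derivative is
          used; as the tag lies in the cell, the two distances add up to its length.\<close>
        have "norm (f (Sup K) - f x) \<le> e * \<bar>Sup K - x\<bar>" "norm (f (Inf K) - f x) \<le> e * \<bar>Inf K - x\<bar>"
          by (intro rad(3)[OF x] close; use K'(2-5) in simp)+
        then have "norm ((f (Sup K) - f x) - (f (Inf K) - f x)) \<le> e * \<bar>Sup K - x\<bar> + e * \<bar>Inf K - x\<bar>"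
          using norm_triangle_ineq4 by (smt (verit))
        then show ?thesis using K'(2,3) by (simp add: algebra_simps)
      qed
    qed
    also have "\<dots> \<le> (\<Sum>(x, K)\<in>p. e * (Sup K - Inf K))"
      using pD(1) K(2,3) \<open>e > 0\<close> by (intro sum_mono2) (force intro: order_trans)+
    also have "\<dots> = e * (b - a)"
      using additive_tagged_division_1[OF \<open>a \<le> b\<close> p(1), of "\<lambda>x. x"]
      by (simp add: case_prod_beta flip: sum_distrib_left)
    finally have small: "(\<Sum>(x, K)\<in>p - p1. norm (f (Sup K) - f (Inf K))) \<le> e * (b - a)" .
    have "norm (f b - f a) = norm (\<Sum>(x, K)\<in>p. f (Sup K) - f (Inf K))"
      using additive_tagged_division_1[OF \<open>a \<le> b\<close> p(1), of f] by simp
    also have "\<dots> \<le> (\<Sum>(x, K)\<in>p. norm (f (Sup K) - f (Inf K)))"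
      by (rule order_trans[OF norm_sum]) (simp add: case_prod_beta)
    also have "\<dots> = (\<Sum>(x, K)\<in>p - p1. norm (f (Sup K) - f (Inf K))) + (\<Sum>(x, K)\<in>p1. norm (f (Sup K) - f (Inf K)))"
      by (rule sum.subset_diff[OF \<open>p1 \<subseteq> p\<close> pD(1)])
    finally show ?thesis using big small by linarith
  qed
  show ?thesis
  proof (rule ccontr)
    assume "f b \<noteq> f a"
    \<comment> \<open>With this \<open>e\<close> the bound equals half of |f b - f a|.\<close>
    define e where "e = norm (f b - f a) / (2 * (1 + (b - a)))"
    have "e > 0" using \<open>f b \<noteq> f a\<close> \<open>a \<le> b\<close> by (simp add: e_def)
    have "norm (f b - f a) = e * (2 * (1 + (b - a)))"
      using \<open>a \<le> b\<close> by (simp add: e_def)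
    then have "norm (f b - f a) = 2 * (e + e * (b - a))" by (simp add: algebra_simps)
    then have "e + e * (b - a) = norm (f b - f a) / 2" by simp
    with bound[OF \<open>e > 0\<close>] have "norm (f b - f a) \<le> norm (f b - f a) / 2" by simp
    with \<open>f b \<noteq> f a\<close> show False by simp
  qed
qed

subsection \<open>Ordinary differential equations on a half-line\<close>

text \<open>The integral is available only for the class \<open>banach\<close>, to which a type of sort
  \<open>{real_normed_vector, complete_space}\<close> does not formally belong; an isometric copy does.\<close>

typedef (overloaded) 'a complete_copy = "UNIV :: 'a::{real_normed_vector, complete_space} set"
  morphisms of_copy to_copy ..

setup_lifting type_definition_complete_copy

instantiation complete_copy :: ("{real_normed_vector, complete_space}") real_vector
begin

lift_definition zero_complete_copy :: "'a complete_copy" is 0 .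
lift_definition plus_complete_copy :: "'a complete_copy \<Rightarrow> 'a complete_copy \<Rightarrow> 'a complete_copy" is "(+)" .
lift_definition minus_complete_copy :: "'a complete_copy \<Rightarrow> 'a complete_copy \<Rightarrow> 'a complete_copy" is "(-)" .
lift_definition uminus_complete_copy :: "'a complete_copy \<Rightarrow> 'a complete_copy" is uminus .
lift_definition scaleR_complete_copy :: "real \<Rightarrow> 'a complete_copy \<Rightarrow> 'a complete_copy" is scaleR .

instance
proof
  fix x y z :: "'a complete_copy" and a b :: real
  show "x + y + z = x + (y + z)" by transfer (rule add.assoc)
  show "x + y = y + x" by transfer (rule add.commute)
  show "0 + x = x" by transfer (rule add_0)
  show "- x + x = 0" by transfer (rule left_minus)
  show "x - y = x + - y" by transfer (rule diff_conv_add_uminus)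
  show "a *\<^sub>R (x + y) = a *\<^sub>R x + a *\<^sub>R y" by transfer (rule scaleR_add_right)
  show "(a + b) *\<^sub>R x = a *\<^sub>R x + b *\<^sub>R x" by transfer (rule scaleR_add_left)
  show "a *\<^sub>R b *\<^sub>R x = (a * b) *\<^sub>R x" by transfer (rule scaleR_scaleR)
  show "1 *\<^sub>R x = x" by transfer (rule scaleR_one)
qed

end

instantiation complete_copy :: ("{real_normed_vector, complete_space}") real_normed_vector
begin

lift_definition norm_complete_copy :: "'a complete_copy \<Rightarrow> real" is norm .
lift_definition dist_complete_copy :: "'a complete_copy \<Rightarrow> 'a complete_copy \<Rightarrow> real" is dist .
lift_definition sgn_complete_copy :: "'a complete_copy \<Rightarrow> 'a complete_copy" is sgn .

definition uniformity_complete_copy :: "('a complete_copy \<times> 'a complete_copy) filter" where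
  "uniformity_complete_copy = (INF e\<in>{0<..}. principal {(x, y). dist x y < e})"

definition open_complete_copy :: "'a complete_copy set \<Rightarrow> bool" where
  "open_complete_copy S = (\<forall>x\<in>S. \<forall>\<^sub>F (x', y) in uniformity. x' = x \<longrightarrow> y \<in> S)"

instance
proof
  fix x y :: "'a complete_copy" and a :: real
  show "dist x y = norm (x - y)" by transfer (rule dist_norm)
  show "sgn x = x /\<^sub>R norm x" by transfer (rule sgn_div_norm)
  show "(norm x = 0) = (x = 0)" by transfer (rule norm_eq_zero)
  show "norm (x + y) \<le> norm x + norm y" by transfer (rule norm_triangle_ineq)
  show "norm (a *\<^sub>R x) = \<bar>a\<bar> * norm x" by transfer (rule norm_scaleR)
qed (rule uniformity_complete_copy_def open_complete_copy_def)+

end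

instance complete_copy :: ("{real_normed_vector, complete_space}") banach
proof
  fix X :: "nat \<Rightarrow> 'a complete_copy"
  assume "Cauchy X"
  then have "Cauchy (\<lambda>n. of_copy (X n))"
    by (simp add: Cauchy_def dist_complete_copy.rep_eq)
  then obtain l where "(\<lambda>n. of_copy (X n)) \<longlonglongrightarrow> l"
    using Cauchy_convergent convergent_def by blast
  then have "X \<longlonglongrightarrow> to_copy l"
    by (simp add: lim_sequentially dist_complete_copy.rep_eq to_copy_inverse)
  then show "convergent X" by (auto simp: convergent_def)
qed

lemma bounded_linear_of_copy: "bounded_linear of_copy"
  by (rule bounded_linear_intro[of _ 1])
    (simp_all add: plus_complete_copy.rep_eq scaleR_complete_copy.rep_eq norm_complete_copy.rep_eq)

lemma bounded_linear_to_copy: "bounded_linear to_copy"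
  by (rule bounded_linear_intro[of _ 1])
    (simp_all add: of_copy_inject[symmetric] to_copy_inverse plus_complete_copy.rep_eq
      scaleR_complete_copy.rep_eq norm_complete_copy.rep_eq)

lemma exists_primitive:
  fixes f :: "real \<Rightarrow> 'a::{real_normed_vector, complete_space}"
  assumes "continuous_on {t0..} f"
  shows "\<exists>F. F t0 = 0 \<and> (\<forall>t\<ge>t0. (F has_vector_derivative f t) (at t within {t0..}))"
proof -
  define g where "g t = to_copy (f t)" for t
  define G where "G t = integral {t0..t} g" for t
  have cont: "continuous_on {t0..} g"
    unfolding g_def by (intro bounded_linear.continuous_on[OF bounded_linear_to_copy] assms)
  have "(G has_vector_derivative g t) (at t within {t0..})" if "t \<ge> t0" for t
  proof -
    have "(G has_vector_derivative g t) (at t within {t0..t + 1})"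
      unfolding G_def using that
      by (intro integral_has_vector_derivative continuous_on_subset[OF cont]) auto
    \<comment> \<open>The integral is differentiated on a compact interval; near \<open>t\<close>
      that interval and the half-line coincide, also for t = \<open>t0\<close>.\<close>
    moreover have "at t within {t0..t + 1} = at t within {t0..}"
      by (rule at_within_nhd[of _ "{..<t + 1}"]) auto
    ultimately show ?thesis by simp
  qed
  then have "((\<lambda>t. of_copy (G t)) has_vector_derivative of_copy (g t)) (at t within {t0..})"
    if "t \<ge> t0" for t
    using that by (intro bounded_linear.has_vector_derivative[OF bounded_linear_of_copy]) simp
  then have "((\<lambda>t. of_copy (G t)) has_vector_derivative f t) (at t within {t0..})" if "t \<ge> t0" for t
    using that by (simp add: g_def to_copy_inverse)
  moreover have "of_copy (G t0) = 0" by (simp add: G_def zero_complete_copy.rep_eq)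
  ultimately show ?thesis by (intro exI[of _ "\<lambda>t. of_copy (G t)"]) simp
qed

section \<open>Mean value inequality, global existence and uniqueness\<close>

lemma at_within_atLeast: "t0 < t \<Longrightarrow> at t within {t0..} = at (t::real)"
  by (rule at_within_interior) simp

lemma has_vector_derivative_atLeast_continuous_on:
  assumes "\<And>t. t \<ge> t0 \<Longrightarrow> (f has_vector_derivative f' t) (at t within {t0..})"
  shows "continuous_on {t0..} f"
  unfolding continuous_on_eq_continuous_within
  using has_vector_derivative_continuous[OF assms] by simp

text \<open>This mean value inequality replaces estimates of integrals: \<phi> is any primitive of a
  bound on the derivative.\<close>

lemma norm_diff_le_primitive:
  fixes f :: "real \<Rightarrow> 'a::real_normed_vector" and \<phi> :: "real \<Rightarrow> real"
  assumes f: "\<And>s. s \<ge> t0 \<Longrightarrow> (f has_vector_derivative f' s) (at s within {t0..})"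
    and \<phi>: "\<And>s. s \<ge> t0 \<Longrightarrow> (\<phi> has_vector_derivative \<phi>' s) (at s within {t0..})"
    and le: "\<And>s. s \<ge> t0 \<Longrightarrow> norm (f' s) \<le> \<phi>' s" and "t \<ge> t0"
  shows "norm (f t - f t0) \<le> \<phi> t - \<phi> t0"
proof (cases "t = t0")
  case False
  then have "t0 < t" using \<open>t \<ge> t0\<close> by simp
  then show ?thesis
  proof (rule differentiable_bound_general[where f' = f' and \<phi>' = \<phi>'])
    show "continuous_on {t0..t} f" "continuous_on {t0..t} \<phi>"
      using has_vector_derivative_atLeast_continuous_on[OF f]
        has_vector_derivative_atLeast_continuous_on[OF \<phi>] by (auto intro: continuous_on_subset)
    fix s assume "t0 < s"
    then show "(f has_vector_derivative f' s) (at s)" "(\<phi> has_vector_derivative \<phi>' s) (at s)"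
      using f[of s] \<phi>[of s] by (auto simp: at_within_atLeast)
  qed (use le in auto)
qed simp

text \<open>The fixed point argument runs in bounded functions \<open>u\<close>, where \<open>z = z0 + w u\<close> for the weight
  \<open>w = exp (2 \<integral> k)\<close>: since \<open>\<integral> k w \<le> w / 2\<close>, the Picard map is a contraction with constant
  \<open>1 / 2\<close> on the whole half-line, and no continuation of local solutions is needed.\<close>

theorem global_ode_solution:
  fixes F :: "real \<Rightarrow> 'b \<Rightarrow> 'b::{real_normed_vector, complete_space}"
  assumes cont: "\<And>z. continuous_on {t0..} z \<Longrightarrow> continuous_on {t0..} (\<lambda>t. F t (z t))"
    and K: "continuous_on {t0..} K"
    and lip: "\<And>t p q. t \<ge> t0 \<Longrightarrow> norm (F t p - F t q) \<le> K t * norm (p - q)"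
  shows "\<exists>z. z t0 = z0 \<and> (\<forall>t\<ge>t0. (z has_vector_derivative F t (z t)) (at t within {t0..}))"
proof -
  \<comment> \<open>The first summand dominates the Lipschitz constant. The second bounds the field
    along the constant function \<open>z0\<close>, which keeps the Picard image of u = 0 below
    \<open>w / 2\<close>.\<close>
  define k where "k t = \<bar>K t\<bar> + norm (F t z0)" for t
  have "continuous_on {t0..} k"
    unfolding k_def by (intro continuous_intros K cont)
  then obtain M where M: "M t0 = 0" "\<And>t. t \<ge> t0 \<Longrightarrow> (M has_vector_derivative k t) (at t within {t0..})"
    using exists_primitive by metis
  define w where "w t = exp (2 * M t)" for t
  have w': "(w has_vector_derivative 2 * k t * w t) (at t within {t0..})" if "t \<ge> t0" for t
    unfolding w_def using M(2)[OF that]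
    by (auto simp: has_real_derivative_iff_has_vector_derivative[symmetric] intro!: derivative_eq_intros)
  have [simp]: "w t > 0" "w t0 = 1" for t by (auto simp: w_def M(1))
  have w_cont: "continuous_on {t0..} w"
    using has_vector_derivative_atLeast_continuous_on[OF w'] .
  have k0: "0 \<le> k t" for t by (simp add: k_def)
  have w1: "1 \<le> w t" if "t \<ge> t0" for t
    using norm_diff_le_primitive[OF _ w', of "\<lambda>_. 0" "\<lambda>_. 0" t] that k0 by (simp add: less_imp_le)
  have klip: "norm (F t p - F t q) \<le> k t * norm (p - q)" if "t \<ge> t0" for t p q
    by (rule order_trans[OF lip[OF that]], rule mult_right_mono)
      (auto simp: k_def intro: add_increasing2)
  define R where "R u t = F t (z0 + w t *\<^sub>R apply_bcontfun u t)" for u t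
  have R_cont: "continuous_on {t0..} (R u)" for u
    unfolding R_def by (intro cont continuous_intros w_cont continuous_on_apply_bcontfun)
  have "\<forall>u. \<exists>P. P t0 = 0 \<and> (\<forall>t\<ge>t0. (P has_vector_derivative R u t) (at t within {t0..}))"
    using exists_primitive[OF R_cont] by blast
  then obtain P where P: "\<And>u. P u t0 = 0"
    "\<And>u t. t \<ge> t0 \<Longrightarrow> (P u has_vector_derivative R u t) (at t within {t0..})" by metis
  \<comment> \<open>The fields differ by at most \<open>k * w * dist u v\<close>, and
    \<open>w / 2\<close> is a primitive of \<open>k * w\<close>.\<close>
  have P_diff: "norm (P u t - P v t) \<le> dist u v / 2 * w t" if "t \<ge> t0" for u v t
  proof -
    let ?B = "dist u v"
    have "norm ((P u t - P v t) - (P u t0 - P v t0)) \<le> ?B / 2 * w t - ?B / 2 * w t0"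
    proof (rule norm_diff_le_primitive[OF _ _ _ that])
      show "((\<lambda>t. P u t - P v t) has_vector_derivative R u s - R v s) (at s within {t0..})" if "s \<ge> t0" for s
        by (intro has_vector_derivative_diff P that)
      show "((\<lambda>s. ?B / 2 * w s) has_vector_derivative ?B / 2 * (2 * k s * w s)) (at s within {t0..})"
        if "s \<ge> t0" for s
        by (intro has_vector_derivative_mult_right w' that)
      show "norm (R u s - R v s) \<le> ?B / 2 * (2 * k s * w s)" if "s \<ge> t0" for s
      proof -
        have "norm (R u s - R v s) \<le> k s * norm (w s *\<^sub>R (apply_bcontfun u s - apply_bcontfun v s))"
          unfolding R_def by (rule order_trans[OF klip[OF that]]) (simp add: algebra_simps)
        also have "\<dots> = k s * (w s * dist (apply_bcontfun u s) (apply_bcontfun v s))"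
          by (simp add: dist_norm less_imp_le)
        also have "\<dots> \<le> k s * (w s * ?B)"
          by (intro mult_left_mono dist_bounded k0) (simp add: less_imp_le)
        finally show ?thesis by (simp add: mult_ac)
      qed
    qed
    also have "\<dots> \<le> ?B / 2 * w t" by simp
    finally show ?thesis by (simp add: P(1))
  qed
  have P_bound: "norm (P 0 t) \<le> 1 / 2 * w t" if "t \<ge> t0" for t
  proof -
    have "norm (P 0 t - P 0 t0) \<le> 1 / 2 * w t - 1 / 2 * w t0"
    proof (rule norm_diff_le_primitive[OF P(2) _ _ that])
      show "((\<lambda>s. 1 / 2 * w s) has_vector_derivative 1 / 2 * (2 * k s * w s)) (at s within {t0..})"
        if "s \<ge> t0" for s
        by (intro has_vector_derivative_mult_right w' that)
      show "norm (R 0 s) \<le> 1 / 2 * (2 * k s * w s)" if "s \<ge> t0" for s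
      proof -
        have "norm (R 0 s) \<le> k s" by (simp add: R_def k_def zero_bcontfun.rep_eq)
        also have "\<dots> \<le> k s * w s" using mult_left_mono[OF w1[OF that] k0] by simp
        finally show ?thesis by simp
      qed
    qed
    then show ?thesis by (simp add: P(1))
  qed
  \<comment> \<open>Bounded continuous functions live on the whole line here, so the Picard image is
    extended by its value at \<open>t0\<close> to the left.\<close>
  define \<Phi>' where "\<Phi>' u t = (1 / w (max t t0)) *\<^sub>R P u (max t t0)" for u t
  have diff: "norm (\<Phi>' u t - \<Phi>' v t) \<le> dist u v / 2" for u v t
  proof -
    have "norm (\<Phi>' u t - \<Phi>' v t) = 1 / w (max t t0) * norm (P u (max t t0) - P v (max t t0))"
      by (simp add: \<Phi>'_def less_imp_le flip: scaleR_diff_right)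
    also have "\<dots> \<le> 1 / w (max t t0) * (dist u v / 2 * w (max t t0))"
      by (intro mult_left_mono P_diff) (auto simp: less_imp_le)
    finally show ?thesis using \<open>\<And>t. w t > 0\<close>[of "max t t0"] by simp
  qed
  have bcont: "\<Phi>' u \<in> bcontfun" for u
  proof (rule bcontfun_normI)
    have "continuous_on {t0..} (\<lambda>t. (1 / w t) *\<^sub>R P u t)"
      using has_vector_derivative_atLeast_continuous_on[OF P(2)] w_cont
      by (intro continuous_intros) (auto simp: less_imp_neq[symmetric])
    then show "continuous_on UNIV (\<Phi>' u)"
      unfolding \<Phi>'_def by (rule continuous_on_compose2) (auto intro!: continuous_intros)
    fix t
    have "norm (\<Phi>' 0 t) = 1 / w (max t t0) * norm (P 0 (max t t0))"
      by (simp add: \<Phi>'_def less_imp_le)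
    also have "\<dots> \<le> 1 / w (max t t0) * (1 / 2 * w (max t t0))"
      by (intro mult_left_mono P_bound) (auto simp: less_imp_le)
    finally have "norm (\<Phi>' 0 t) \<le> 1 / 2" using \<open>\<And>t. w t > 0\<close>[of "max t t0"] by simp
    then show "norm (\<Phi>' u t) \<le> 1 / 2 + dist u 0 / 2"
      using diff[of u t 0] norm_triangle_ineq2[of "\<Phi>' u t" "\<Phi>' 0 t"] by linarith
  qed
  define \<Phi> where "\<Phi> u = Bcontfun (\<Phi>' u)" for u
  have \<Phi>: "apply_bcontfun (\<Phi> u) = \<Phi>' u" for u
    unfolding \<Phi>_def using bcont by (rule Bcontfun_inverse)
  have "\<exists>!u. \<Phi> u = u"
  proof (rule banach_fix_type)
    show "\<forall>u v. dist (\<Phi> u) (\<Phi> v) \<le> 1 / 2 * dist u v"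
    proof (intro allI dist_bound)
      show "dist (apply_bcontfun (\<Phi> u) t) (apply_bcontfun (\<Phi> v) t) \<le> 1 / 2 * dist u v" for u v t
        using diff[of u t v] by (simp add: \<Phi> dist_norm[of "\<Phi>' u t"])
    qed
  qed auto
  then obtain u where "\<Phi> u = u" by blast
  then have u: "apply_bcontfun u t = (1 / w t) *\<^sub>R P u t" if "t \<ge> t0" for t
    using \<Phi>[of u] that by (simp add: \<Phi>'_def max_absorb1)
  show ?thesis
  proof (intro exI[of _ "\<lambda>t. z0 + P u t"] conjI allI impI)
    fix t assume "t \<ge> t0"
    have "w t \<noteq> 0" using \<open>\<And>t. w t > 0\<close>[of t] by linarith
    then have "R u t = F t (z0 + P u t)" using u[OF \<open>t \<ge> t0\<close>] by (simp add: R_def)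
    then show "((\<lambda>t. z0 + P u t) has_vector_derivative F t (z0 + P u t)) (at t within {t0..})"
      using has_vector_derivative_add[OF has_vector_derivative_const[of z0] P(2)[OF \<open>t \<ge> t0\<close>, of u]]
      by simp
  next
    show "z0 + P u t0 = z0" by (simp only: P(1) add_0_right)
  qed
qed

text \<open>Gronwall's argument: the squared distance of two solutions, weighted by exp (-2 M) with
  M' = K, is nonincreasing and starts at 0.\<close>

theorem ode_solution_unique:
  fixes F :: "real \<Rightarrow> 'b \<Rightarrow> 'b::real_inner"
  assumes K: "continuous_on {t0..} K"
    and lip: "\<And>t p q. t \<ge> t0 \<Longrightarrow> norm (F t p - F t q) \<le> K t * norm (p - q)"
    and z: "\<And>t. t \<ge> t0 \<Longrightarrow> (z has_vector_derivative F t (z t)) (at t within {t0..})"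
    and z': "\<And>t. t \<ge> t0 \<Longrightarrow> (z' has_vector_derivative F t (z' t)) (at t within {t0..})"
    and init: "z t0 = z' t0" and "t \<ge> t0"
  shows "z t = z' t"
proof -
  obtain M where M: "\<And>t. t \<ge> t0 \<Longrightarrow> (M has_vector_derivative K t) (at t within {t0..})"
    using exists_primitive[OF K] by blast
  define d where "d t = z t - z' t" for t
  define d' where "d' t = F t (z t) - F t (z' t)" for t
  define \<phi> where "\<phi> t = exp (- 2 * M t) * (d t \<bullet> d t)" for t
  have d: "(d has_vector_derivative d' t) (at t within {t0..})" if "t \<ge> t0" for t
    unfolding d_def d'_def by (intro has_vector_derivative_diff z z' that)
  have \<phi>: "(\<phi> has_vector_derivative exp (- 2 * M t) * (2 * (d' t \<bullet> d t) - 2 * K t * (d t \<bullet> d t)))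
      (at t within {t0..})" if "t \<ge> t0" for t
  proof -
    have "((\<lambda>t. d t \<bullet> d t) has_vector_derivative 2 * (d' t \<bullet> d t)) (at t within {t0..})"
      using has_derivative_inner[OF d[OF that, unfolded has_vector_derivative_def]
          d[OF that, unfolded has_vector_derivative_def]]
      by (simp add: has_vector_derivative_def inner_commute algebra_simps)
    moreover have "((\<lambda>t. exp (- 2 * M t)) has_real_derivative exp (- 2 * M t) * (- 2 * K t)) (at t within {t0..})"
      using M[OF that]
      by (auto simp: has_real_derivative_iff_has_vector_derivative[symmetric] intro!: derivative_eq_intros)
    ultimately have "((\<lambda>t. exp (- 2 * M t) * (d t \<bullet> d t)) has_real_derivative
        exp (- 2 * M t) * (- 2 * K t) * (d t \<bullet> d t) + 2 * (d' t \<bullet> d t) * exp (- 2 * M t)) (at t within {t0..})"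
      unfolding has_real_derivative_iff_has_vector_derivative[symmetric] by (rule DERIV_mult[rotated])
    then show ?thesis
      unfolding \<phi>_def has_real_derivative_iff_has_vector_derivative[symmetric]
      by (simp add: algebra_simps)
  qed
  have "\<phi> t \<le> \<phi> t0"
  proof (rule DERIV_nonpos_imp_decreasing_open[OF \<open>t \<ge> t0\<close>])
    show "continuous_on {t0..t} \<phi>"
      using has_vector_derivative_atLeast_continuous_on[OF \<phi>] by (rule continuous_on_subset) auto
    fix s assume "t0 < s"
    then have "d' s \<bullet> d s \<le> norm (d' s) * norm (d s)" by (intro norm_cauchy_schwarz)
    also have "\<dots> \<le> K s * norm (d s) * norm (d s)"
      using lip[of s "z s" "z' s"] \<open>t0 < s\<close> by (intro mult_right_mono) (auto simp: d_def d'_def)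
    finally have "d' s \<bullet> d s \<le> K s * (d s \<bullet> d s)"
      by (simp add: power2_norm_eq_inner[symmetric] power2_eq_square mult_ac)
    then have "exp (- 2 * M s) * (2 * (d' s \<bullet> d s) - 2 * K s * (d s \<bullet> d s)) \<le> 0"
      by (intro mult_nonneg_nonpos) auto
    then show "\<exists>y. (\<phi> has_real_derivative y) (at s) \<and> y \<le> 0"
      using \<phi>[of s] \<open>t0 < s\<close>
      by (auto simp: at_within_atLeast has_real_derivative_iff_has_vector_derivative)
  qed
  then have "exp (- 2 * M t) * (d t \<bullet> d t) \<le> 0" by (simp add: \<phi>_def d_def init)
  then have "d t \<bullet> d t \<le> 0" by (simp add: mult_le_0_iff)
  then have "d t = 0" by (metis inner_eq_zero_iff inner_ge_zero order_antisym)
  then show ?thesis by (simp add: d_def)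
qed

subsection \<open>Reduction to a first-order system\<close>

lemma AE_lebesgue_on_iff:
  "(AE t in lebesgue_on {t0..}. P t) \<longleftrightarrow> (\<exists>N. negligible N \<and> (\<forall>t\<ge>t0. t \<notin> N \<longrightarrow> P t))"
  for t0 :: real
proof -
  have "(AE t in lebesgue_on {t0..}. P t) \<longleftrightarrow> (AE t in lebesgue. t \<in> {t0..} \<longrightarrow> P t)"
    by (rule AE_restrict_space_iff) simp
  also have "\<dots> \<longleftrightarrow> (\<exists>N\<in>null_sets lebesgue. {t. \<not> (t \<in> {t0..} \<longrightarrow> P t)} \<subseteq> N)"
    by (simp add: eventually_ae_filter)
  also have "\<dots> \<longleftrightarrow> (\<exists>N. negligible N \<and> (\<forall>t\<ge>t0. t \<notin> N \<longrightarrow> P t))"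
    by (auto simp: negligible_iff_null_sets)
  finally show ?thesis .
qed

lemma absolutely_continuous_imp_continuous_on:
  assumes "absolutely_continuous_on_interval a b f"
  shows "continuous_on {a..b} f"
  unfolding continuous_on_iff
proof (intro ballI allI impI)
  fix t e :: real assume t: "t \<in> {a..b}" and "e > 0"
  obtain d where "d > 0" and d: "\<And>I. finite I \<Longrightarrow> (\<And>r s. (r, s) \<in> I \<Longrightarrow> a \<le> r \<and> r \<le> s \<and> s \<le> b) \<Longrightarrow>
      disjoint_family_on (\<lambda>(r, s). {r<..<s}) I \<Longrightarrow> (\<Sum>(r, s)\<in>I. s - r) < d
      \<Longrightarrow> (\<Sum>(r, s)\<in>I. norm (f s - f r)) < e"
    using absolutely_continuous_on_intervalE[OF assms \<open>e > 0\<close>] by metis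
  have close: "norm (f s - f r) < e" if "a \<le> r" "r \<le> s" "s \<le> b" "s - r < d" for r s
    using d[of "{(r, s)}"] that by (simp add: disjoint_family_on_def)
  show "\<exists>d>0. \<forall>s\<in>{a..b}. dist s t < d \<longrightarrow> dist (f s) (f t) < e"
  proof (intro exI conjI ballI impI)
    fix s assume s: "s \<in> {a..b}" "dist s t < d"
    show "dist (f s) (f t) < e"
    proof (cases "s \<le> t")
      case True
      then show ?thesis using close[of s t] s t by (simp add: dist_norm norm_minus_commute)
    next
      case False
      then show ?thesis using close[of t s] s t by (simp add: dist_norm)
    qed
  qed fact
qed

lemma continuous_on_atLeast_if_bounded_intervals:
  assumes "\<And>T. T > t0 \<Longrightarrow> continuous_on {t0..T} f"
  shows "continuous_on {t0..} (f :: real \<Rightarrow> 'a::topological_space)"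
  unfolding continuous_on_eq_continuous_within
proof
  fix t assume t: "t \<in> {t0..}"
  have "continuous (at t within {t0..t + 1}) f"
    using assms[of "t + 1"] t by (auto simp: continuous_on_eq_continuous_within)
  moreover have "at t within {t0..t + 1} = at t within {t0..}"
    by (rule at_within_nhd[of _ "{..<t + 1}"]) auto
  ultimately show "continuous (at t within {t0..}) f" by simp
qed

lemma continuous_derivative_imp_lipschitz:
  fixes f :: "real \<Rightarrow> 'a::real_normed_vector"
  assumes f: "\<And>t. t \<ge> t0 \<Longrightarrow> (f has_vector_derivative f' t) (at t within {t0..})"
    and "continuous_on {t0..} f'"
  shows "\<exists>L. L-lipschitz_on {t0..T} f"
proof -
  have "continuous_on {t0..T} f'" using assms(2) by (rule continuous_on_subset) auto
  then have "bounded (f' ` {t0..T})"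
    by (intro compact_imp_bounded compact_continuous_image) auto
  then obtain B where "B > 0" and B: "\<And>t. t \<in> {t0..T} \<Longrightarrow> norm (f' t) \<le> B"
    by (auto simp: bounded_pos)
  have "B-lipschitz_on {t0..T} f"
  proof (rule bounded_derivative_imp_lipschitz)
    show "(f has_derivative (\<lambda>h. h *\<^sub>R f' t)) (at t within {t0..T})" if "t \<in> {t0..T}" for t
      using has_vector_derivative_within_subset[OF f[of t], of "{t0..T}"] that
      by (auto simp: has_vector_derivative_def)
    show "onorm (\<lambda>h. h *\<^sub>R f' t) \<le> B" if "t \<in> {t0..T}" for t
      using B[OF that] \<open>B > 0\<close> by (intro onorm_le) (auto simp: mult.commute[of B] intro: mult_left_mono)
  qed (use \<open>B > 0\<close> in auto)
  then show ?thesis ..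
qed

lemma lipschitz_on_scaleR:
  fixes f :: "real \<Rightarrow> 'a::real_normed_vector" and c :: "real \<Rightarrow> real"
  assumes c: "M-lipschitz_on {a..b} c" and f: "L-lipschitz_on {a..b} f"
  shows "\<exists>K. K-lipschitz_on {a..b} (\<lambda>t. c t *\<^sub>R f t)"
proof -
  have "bounded (c ` {a..b})" "bounded (f ` {a..b})"
    using lipschitz_on_continuous_on[OF c] lipschitz_on_continuous_on[OF f]
    by (auto intro!: compact_imp_bounded compact_continuous_image)
  then obtain C D where "C > 0" "D > 0"
    and C: "\<And>t. t \<in> {a..b} \<Longrightarrow> \<bar>c t\<bar> \<le> C" and D: "\<And>t. t \<in> {a..b} \<Longrightarrow> norm (f t) \<le> D"
    by (auto simp: bounded_pos)
  have "L \<ge> 0" "M \<ge> 0" using c f by (auto intro: lipschitz_on_nonneg)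
  have "(C * L + M * D)-lipschitz_on {a..b} (\<lambda>t. c t *\<^sub>R f t)"
  proof (rule lipschitz_onI)
    fix r s assume rs: "r \<in> {a..b}" "s \<in> {a..b}"
    have "c r *\<^sub>R f r - c s *\<^sub>R f s = c r *\<^sub>R (f r - f s) + (c r - c s) *\<^sub>R f s"
      by (simp add: algebra_simps)
    then have "norm (c r *\<^sub>R f r - c s *\<^sub>R f s) \<le> \<bar>c r\<bar> * norm (f r - f s) + \<bar>c r - c s\<bar> * norm (f s)"
      by (metis norm_scaleR norm_triangle_ineq)
    also have "\<dots> \<le> C * (L * \<bar>r - s\<bar>) + (M * \<bar>r - s\<bar>) * D"
      using C[OF rs(1)] D[OF rs(2)] lipschitz_on_normD[OF f rs] lipschitz_on_normD[OF c rs]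
        \<open>C > 0\<close> \<open>D > 0\<close> \<open>L \<ge> 0\<close> \<open>M \<ge> 0\<close>
      by (intro add_mono mult_mono) auto
    finally show "dist (c r *\<^sub>R f r) (c s *\<^sub>R f s) \<le> (C * L + M * D) * dist r s"
      by (simp add: dist_norm algebra_simps)
  qed (use \<open>C > 0\<close> \<open>D > 0\<close> \<open>L \<ge> 0\<close> \<open>M \<ge> 0\<close> in auto)
  then show ?thesis ..
qed

section \<open>The first-order system for a Lipschitz map and abstract coefficients\<close>

context
  fixes Y :: "'a::{real_inner, complete_space} \<Rightarrow> 'a" and l t0 :: real
    and p b b' \<epsilon> \<epsilon>' :: "real \<Rightarrow> real"
  assumes Y: "l-lipschitz_on UNIV Y"
    and p: "continuous_on {t0..} p"
    and b: "\<And>t. t \<ge> t0 \<Longrightarrow> (b has_real_derivative b' t) (at t within {t0..})"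
    and b': "continuous_on {t0..} b'"
    and \<epsilon>: "\<And>t. t \<ge> t0 \<Longrightarrow> (\<epsilon> has_real_derivative \<epsilon>' t) (at t within {t0..})"
    and \<epsilon>': "continuous_on {t0..} \<epsilon>'"
begin

definition "tikhonov t x = Y x + \<epsilon> t *\<^sub>R x"

definition "reduced_velocity t z = snd z - b t *\<^sub>R tikhonov t (fst z)"

text \<open>The first-order system for \<open>(x, y)\<close> with \<open>y = x' + b (Y x + \<epsilon> x)\<close>, in which the derivative of
  \<open>Y x\<close> no longer occurs.\<close>
definition "reduced_field t z =
  (reduced_velocity t z, - p t *\<^sub>R reduced_velocity t z + (b' t - 1) *\<^sub>R tikhonov t (fst z))"

lemma cont_b: "continuous_on {t0..} b" and cont_\<epsilon>: "continuous_on {t0..} \<epsilon>"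
  using DERIV_continuous[OF b] DERIV_continuous[OF \<epsilon>] by (auto simp: continuous_on_eq_continuous_within)

lemma cont_Y: "continuous_on UNIV Y"
  using Y by (rule lipschitz_on_continuous_on)

lemma continuous_on_tikhonov:
  assumes "continuous_on {t0..} x"
  shows "continuous_on {t0..} (\<lambda>t. tikhonov t (x t))"
  unfolding tikhonov_def
  by (intro continuous_intros cont_\<epsilon> assms continuous_on_compose2[OF cont_Y assms]) auto

lemma continuous_on_reduced_velocity:
  assumes "continuous_on {t0..} z"
  shows "continuous_on {t0..} (\<lambda>t. reduced_velocity t (z t))"
  unfolding reduced_velocity_def by (intro continuous_intros cont_b continuous_on_tikhonov assms)

lemma continuous_on_reduced_field:
  assumes "continuous_on {t0..} z"
  shows "continuous_on {t0..} (\<lambda>t. reduced_field t (z t))"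
  unfolding reduced_field_def
  by (intro continuous_intros p b' continuous_on_tikhonov continuous_on_reduced_velocity assms)

text \<open>Here \<open>l + \<bar>\<epsilon> t\<bar>\<close> is a Lipschitz constant of
  \<open>tikhonov t\<close>, and \<open>1 + \<bar>b t\<bar> * (l + \<bar>\<epsilon> t\<bar>)\<close>
  one of the velocity, which enters the two components of the field with factors 1 and
  \<open>- p t\<close>.\<close>

definition "reduced_bound t =
  (1 + \<bar>p t\<bar>) * (1 + \<bar>b t\<bar> * (l + \<bar>\<epsilon> t\<bar>)) + \<bar>b' t - 1\<bar> * (l + \<bar>\<epsilon> t\<bar>)"

lemma continuous_on_reduced_bound: "continuous_on {t0..} reduced_bound"
  unfolding reduced_bound_def by (intro continuous_intros p cont_b b' cont_\<epsilon>)

lemma reduced_field_lipschitz: "norm (reduced_field t z - reduced_field t z') \<le> reduced_bound t * norm (z - z')"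
proof -
  let ?n = "norm (z - z')" and ?c = "l + \<bar>\<epsilon> t\<bar>"
  have fst_le: "norm (fst z - fst z') \<le> ?n" and snd_le: "norm (snd z - snd z') \<le> ?n"
    using norm_fst_le[of "fst z - fst z'" "snd z - snd z'"] norm_snd_le[of "snd z - snd z'" "fst z - fst z'"]
    by (simp_all add: minus_prod_def)
  have "l \<ge> 0" using Y by (rule lipschitz_on_nonneg)
  have tikhonov: "norm (tikhonov t (fst z) - tikhonov t (fst z')) \<le> ?c * ?n"
  proof -
    have "tikhonov t (fst z) - tikhonov t (fst z') = (Y (fst z) - Y (fst z')) + \<epsilon> t *\<^sub>R (fst z - fst z')"
      by (simp add: tikhonov_def algebra_simps)
    then have "norm (tikhonov t (fst z) - tikhonov t (fst z')) \<le>
        norm (Y (fst z) - Y (fst z')) + \<bar>\<epsilon> t\<bar> * norm (fst z - fst z')"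
      by (metis norm_scaleR norm_triangle_ineq)
    also have "\<dots> \<le> l * norm (fst z - fst z') + \<bar>\<epsilon> t\<bar> * norm (fst z - fst z')"
      using lipschitz_on_normD[OF Y, of "fst z" "fst z'"] by simp
    also have "\<dots> \<le> l * ?n + \<bar>\<epsilon> t\<bar> * ?n"
      using fst_le \<open>l \<ge> 0\<close> by (intro add_mono mult_left_mono) auto
    finally show ?thesis by (simp add: algebra_simps)
  qed
  have velocity: "norm (reduced_velocity t z - reduced_velocity t z') \<le> (1 + \<bar>b t\<bar> * ?c) * ?n"
  proof -
    have "reduced_velocity t z - reduced_velocity t z' = (snd z - snd z') - b t *\<^sub>R (tikhonov t (fst z) - tikhonov t (fst z'))"
      by (simp add: reduced_velocity_def algebra_simps)
    then have "norm (reduced_velocity t z - reduced_velocity t z') \<le>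
        norm (snd z - snd z') + \<bar>b t\<bar> * norm (tikhonov t (fst z) - tikhonov t (fst z'))"
      by (metis norm_scaleR norm_triangle_ineq4)
    also have "\<dots> \<le> ?n + \<bar>b t\<bar> * (?c * ?n)"
      using snd_le tikhonov by (intro add_mono mult_left_mono) auto
    finally show ?thesis by (simp add: algebra_simps)
  qed
  have "snd (reduced_field t z) - snd (reduced_field t z') =
      (b' t - 1) *\<^sub>R (tikhonov t (fst z) - tikhonov t (fst z')) - p t *\<^sub>R (reduced_velocity t z - reduced_velocity t z')"
    by (simp add: reduced_field_def algebra_simps)
  then have "norm (snd (reduced_field t z) - snd (reduced_field t z')) \<le>
      \<bar>b' t - 1\<bar> * norm (tikhonov t (fst z) - tikhonov t (fst z')) + \<bar>p t\<bar> * norm (reduced_velocity t z - reduced_velocity t z')"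
    by (metis norm_scaleR norm_triangle_ineq4)
  also have "\<dots> \<le> \<bar>b' t - 1\<bar> * (?c * ?n) + \<bar>p t\<bar> * ((1 + \<bar>b t\<bar> * ?c) * ?n)"
    using tikhonov velocity by (intro add_mono mult_left_mono) auto
  finally have snd: "norm (snd (reduced_field t z) - snd (reduced_field t z')) \<le> \<dots>" .
  have "reduced_field t z - reduced_field t z' = (reduced_velocity t z - reduced_velocity t z', snd (reduced_field t z) - snd (reduced_field t z'))"
    by (simp add: reduced_field_def)
  then have "norm (reduced_field t z - reduced_field t z') \<le>
      norm (reduced_velocity t z - reduced_velocity t z') + norm (snd (reduced_field t z) - snd (reduced_field t z'))"
    by (metis norm_Pair_le)
  also have "\<dots> \<le> (1 + \<bar>b t\<bar> * ?c) * ?n + (\<bar>b' t - 1\<bar> * (?c * ?n) + \<bar>p t\<bar> * ((1 + \<bar>b t\<bar> * ?c) * ?n))"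
    using velocity snd by (rule add_mono)
  also have "\<dots> = reduced_bound t * ?n" by (simp add: reduced_bound_def algebra_simps)
  finally show ?thesis .
qed

text \<open>Along a C^1 curve the composition with \<open>Y\<close> is Lipschitz on bounded
  intervals, though perhaps not differentiable everywhere. The first part serves differentiability
  almost everywhere, the second the absolute continuity of x' and the comparison of \<open>y\<close>
  with a primitive.\<close>

lemma lipschitz_on_tikhonov:
  assumes x: "\<And>t. t \<ge> t0 \<Longrightarrow> (x has_vector_derivative v t) (at t within {t0..})"
    and v: "continuous_on {t0..} v"
  shows "\<exists>L. L-lipschitz_on {t0..T} (\<lambda>t. Y (x t))"
    and "\<exists>L. L-lipschitz_on {t0..T} (\<lambda>t. b t *\<^sub>R tikhonov t (x t))"
proof -
  have x_cont: "continuous_on {t0..} x" by (rule has_vector_derivative_atLeast_continuous_on[OF x])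
  obtain L where L: "L-lipschitz_on {t0..T} x"
    using continuous_derivative_imp_lipschitz[OF x v] by blast
  have Yx: "(l * L)-lipschitz_on {t0..T} (\<lambda>t. Y (x t))"
    by (intro lipschitz_on_compose2 L lipschitz_on_subset[OF Y]) auto
  then show "\<exists>L. L-lipschitz_on {t0..T} (\<lambda>t. Y (x t))" by blast
  obtain M where M: "M-lipschitz_on {t0..T} (\<lambda>t. \<epsilon> t *\<^sub>R x t)"
    using continuous_derivative_imp_lipschitz[of t0 "\<lambda>t. \<epsilon> t *\<^sub>R x t" "\<lambda>t. \<epsilon> t *\<^sub>R v t + \<epsilon>' t *\<^sub>R x t" T]
      has_vector_derivative_scaleR[OF \<epsilon> x]
      continuous_on_add[OF continuous_on_scaleR[OF cont_\<epsilon> v] continuous_on_scaleR[OF \<epsilon>' x_cont]]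
    by blast
  obtain B where "B-lipschitz_on {t0..T} b"
    using continuous_derivative_imp_lipschitz[of t0 b b' T] b b'
    by (auto simp: has_real_derivative_iff_has_vector_derivative)
  then show "\<exists>L. L-lipschitz_on {t0..T} (\<lambda>t. b t *\<^sub>R tikhonov t (x t))"
    unfolding tikhonov_def by (rule lipschitz_on_scaleR[OF _ lipschitz_on_add[OF Yx M]])
qed

text \<open>This is \<open>strong_global_solution\<close> with the Yosida regularization and the
  coefficients replaced by \<open>Y\<close>, \<open>p\<close> and \<open>b\<close>.\<close>

definition "second_order_solution x0 x1 x \<longleftrightarrow>
  (\<exists>v. (\<forall>t\<ge>t0. (x has_vector_derivative v t) (at t within {t0..})) \<and>
    locally_absolutely_continuous t0 x \<and> locally_absolutely_continuous t0 v \<and>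
    (AE t in lebesgue_on {t0..}. \<exists>a w.
      (v has_vector_derivative a) (at t within {t0..}) \<and>
      ((\<lambda>s. tikhonov s (x s)) has_vector_derivative w) (at t within {t0..}) \<and>
      a + p t *\<^sub>R v t + b t *\<^sub>R w + tikhonov t (x t) = 0) \<and>
    x t0 = x0 \<and> v t0 = x1)"

lemma second_order_solution_exists: "\<exists>x \<in> extensional {t0..}. second_order_solution x0 x1 x"
proof -
  obtain z1 where z1: "z1 t0 = (x0, x1 + b t0 *\<^sub>R tikhonov t0 x0)"
    "\<And>t. t \<ge> t0 \<Longrightarrow> (z1 has_vector_derivative reduced_field t (z1 t)) (at t within {t0..})"
    using global_ode_solution[OF continuous_on_reduced_field continuous_on_reduced_bound reduced_field_lipschitz] by metis
  \<comment> \<open>Redefining the solution left of \<open>t0\<close> makes its first component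
    extensional; nothing changes on the half-line.\<close>
  define z where "z t = (if t0 \<le> t then z1 t else (undefined, 0))" for t
  have z0: "z t0 = (x0, x1 + b t0 *\<^sub>R tikhonov t0 x0)" by (simp add: z_def z1)
  have z: "(z has_vector_derivative reduced_field t (z t)) (at t within {t0..})" if "t \<ge> t0" for t
    by (rule has_vector_derivative_transform[of t "{t0..}" z z1]) (use that z1(2) in \<open>auto simp: z_def\<close>)
  define x where "x t = fst (z t)" for t
  define y where "y t = snd (z t)" for t
  define v where "v t = reduced_velocity t (z t)" for t
  define y' where "y' t = - p t *\<^sub>R v t + (b' t - 1) *\<^sub>R tikhonov t (x t)" for t
  have z_cont: "continuous_on {t0..} z" by (rule has_vector_derivative_atLeast_continuous_on[OF z])
  have v_cont: "continuous_on {t0..} v" unfolding v_def by (rule continuous_on_reduced_velocity[OF z_cont])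
  have x: "(x has_vector_derivative v t) (at t within {t0..})" if "t \<ge> t0" for t
    using bounded_linear.has_vector_derivative[OF bounded_linear_fst z[OF that]]
    by (simp add: reduced_field_def x_def[abs_def] v_def)
  have y: "(y has_vector_derivative y' t) (at t within {t0..})" if "t \<ge> t0" for t
    using bounded_linear.has_vector_derivative[OF bounded_linear_snd z[OF that]]
    by (simp add: reduced_field_def x_def y_def[abs_def] v_def y'_def)
  have x_cont: "continuous_on {t0..} x" by (rule has_vector_derivative_atLeast_continuous_on[OF x])
  have y'_cont: "continuous_on {t0..} y'"
    unfolding y'_def by (intro continuous_intros p b' v_cont continuous_on_tikhonov x_cont)
  have v_eq: "v = (\<lambda>t. y t - b t *\<^sub>R tikhonov t (x t))"
    by (auto simp: v_def reduced_velocity_def x_def y_def)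
  have lac_x: "locally_absolutely_continuous t0 x"
    using continuous_derivative_imp_lipschitz[OF x v_cont] lipschitz_imp_absolutely_continuous
    unfolding locally_absolutely_continuous_def by blast
  have lac_v: "locally_absolutely_continuous t0 v"
    unfolding locally_absolutely_continuous_def
  proof (intro allI impI)
    fix T
    obtain L M where "L-lipschitz_on {t0..T} y" "M-lipschitz_on {t0..T} (\<lambda>t. b t *\<^sub>R tikhonov t (x t))"
      using continuous_derivative_imp_lipschitz[OF y y'_cont] lipschitz_on_tikhonov(2)[OF x v_cont] by metis
    then have "(L + M)-lipschitz_on {t0..T} v" unfolding v_eq by (rule lipschitz_on_diff)
    then show "absolutely_continuous_on_interval t0 T v" by (rule lipschitz_imp_absolutely_continuous)
  qed
  \<comment> \<open>Differentiability almost everywhere holds on bounded open intervals, hence the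
    countable union. The point \<open>t0\<close> lies in none of them and is added to the
    exceptional set.\<close>
  define N where "N = (\<Union>n. {t \<in> {t0<..<t0 + real n}. \<nexists>D. ((\<lambda>t. Y (x t)) has_vector_derivative D) (at t)})"
  have "negligible {t \<in> {t0<..<t0 + real n}. \<nexists>D. ((\<lambda>t. Y (x t)) has_vector_derivative D) (at t)}" for n
  proof -
    obtain L where "L-lipschitz_on {t0..t0 + real n} (\<lambda>t. Y (x t))"
      using lipschitz_on_tikhonov(1)[OF x v_cont] by blast
    then show ?thesis by (rule lipschitz_differentiable_ae)
  qed
  then have "negligible N" unfolding N_def by (intro negligible_countable_Union) auto
  then have neg: "negligible (insert t0 N)" by simp
  have "\<exists>a w. (v has_vector_derivative a) (at t within {t0..}) \<and>
      ((\<lambda>s. tikhonov s (x s)) has_vector_derivative w) (at t within {t0..}) \<and>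
      a + p t *\<^sub>R v t + b t *\<^sub>R w + tikhonov t (x t) = 0" if t: "t \<ge> t0" "t \<notin> insert t0 N" for t
  proof -
    have "t > t0" using t by auto
    obtain n where "t - t0 < real n" using reals_Archimedean2 by blast
    then have "t \<in> {t0<..<t0 + real n}" using \<open>t > t0\<close> by simp
    then obtain D where "((\<lambda>t. Y (x t)) has_vector_derivative D) (at t)"
      using t(2) unfolding N_def by blast
    then have D: "((\<lambda>t. Y (x t)) has_vector_derivative D) (at t within {t0..})"
      by (rule has_vector_derivative_at_within)
    define w where "w = D + (\<epsilon> t *\<^sub>R v t + \<epsilon>' t *\<^sub>R x t)"
    have w: "((\<lambda>s. tikhonov s (x s)) has_vector_derivative w) (at t within {t0..})"
      unfolding tikhonov_def w_def using t(1)
      by (intro has_vector_derivative_add D has_vector_derivative_scaleR \<epsilon> x)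
    have "(v has_vector_derivative y' t - (b t *\<^sub>R w + b' t *\<^sub>R tikhonov t (x t))) (at t within {t0..})"
      unfolding v_eq using t(1)
      by (intro has_vector_derivative_diff y has_vector_derivative_scaleR b w)
    \<comment> \<open>In y' - (b g)' the terms with b' cancel, and what remains is the second-order
      equation.\<close>
    moreover have "y' t - (b t *\<^sub>R w + b' t *\<^sub>R tikhonov t (x t)) + p t *\<^sub>R v t + b t *\<^sub>R w + tikhonov t (x t) = 0"
      by (simp add: y'_def algebra_simps)
    ultimately show ?thesis using w by blast
  qed
  then have ae: "AE t in lebesgue_on {t0..}. \<exists>a w. (v has_vector_derivative a) (at t within {t0..}) \<and>
      ((\<lambda>s. tikhonov s (x s)) has_vector_derivative w) (at t within {t0..}) \<and>
      a + p t *\<^sub>R v t + b t *\<^sub>R w + tikhonov t (x t) = 0"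
    unfolding AE_lebesgue_on_iff using neg by blast
  have "x t0 = x0" "v t0 = x1" by (auto simp: x_def v_def reduced_velocity_def z0)
  moreover have "x \<in> extensional {t0..}" by (auto simp: extensional_def x_def z_def)
  ultimately show ?thesis
    using x lac_x lac_v ae unfolding second_order_solution_def by blast
qed

text \<open>For a strong solution the equation gives the derivative of \<open>y\<close> almost
  everywhere, and this derivative agrees with the continuous function \<open>y'\<close>. Absolute
  continuity then identifies \<open>y\<close> with a primitive of \<open>y'\<close>, so the system
  holds at every time.\<close>

lemma second_order_solution_imp_reduced:
  assumes "second_order_solution x0 x1 x"
  obtains z where "z t0 = (x0, x1 + b t0 *\<^sub>R tikhonov t0 x0)" "\<And>t. fst (z t) = x t"
    "\<And>t. t \<ge> t0 \<Longrightarrow> (z has_vector_derivative reduced_field t (z t)) (at t within {t0..})"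
proof -
  let ?P = "\<lambda>v t. \<exists>a w. (v has_vector_derivative a) (at t within {t0..}) \<and>
      ((\<lambda>s. tikhonov s (x s)) has_vector_derivative w) (at t within {t0..}) \<and>
      a + p t *\<^sub>R v t + b t *\<^sub>R w + tikhonov t (x t) = 0"
  obtain v where x': "\<forall>t\<ge>t0. (x has_vector_derivative v t) (at t within {t0..})"
    and lac: "locally_absolutely_continuous t0 v"
    and ae': "AE t in lebesgue_on {t0..}. ?P v t"
    and init: "x t0 = x0" "v t0 = x1"
    using assms unfolding second_order_solution_def by (elim exE conjE) (rule that)
  obtain N where N: "negligible N" and ae: "\<forall>t\<ge>t0. t \<notin> N \<longrightarrow> ?P v t"
    using ae' unfolding AE_lebesgue_on_iff by (elim exE conjE) (rule that)
  have x: "(x has_vector_derivative v t) (at t within {t0..})" if "t \<ge> t0" for t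
    using x' that by blast
  have v_cont: "continuous_on {t0..} v"
    using lac absolutely_continuous_imp_continuous_on
    by (intro continuous_on_atLeast_if_bounded_intervals) (auto simp: locally_absolutely_continuous_def)
  have x_cont: "continuous_on {t0..} x" by (rule has_vector_derivative_atLeast_continuous_on[OF x])
  define y where "y t = v t + b t *\<^sub>R tikhonov t (x t)" for t
  define y' where "y' t = - p t *\<^sub>R v t + (b' t - 1) *\<^sub>R tikhonov t (x t)" for t
  have y'_cont: "continuous_on {t0..} y'"
    unfolding y'_def by (intro continuous_intros p b' v_cont continuous_on_tikhonov x_cont)
  then obtain H where H0: "H t0 = 0" and H: "\<And>t. t \<ge> t0 \<Longrightarrow> (H has_vector_derivative y' t) (at t within {t0..})"
    using exists_primitive by metis
  have y_eq: "y t = y t0 + H t" if "t \<ge> t0" for t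
  proof (cases "t = t0")
    case False
    then have "t0 < t" using that by simp
    obtain L where L: "L-lipschitz_on {t0..t} (\<lambda>t. b t *\<^sub>R tikhonov t (x t) - H t)"
      using lipschitz_on_diff lipschitz_on_tikhonov(2)[OF x v_cont] continuous_derivative_imp_lipschitz[OF H y'_cont]
      by metis
    \<comment> \<open>Absolute continuity of \<open>v\<close> comes from the definition of a strong
      solution; the other terms are even Lipschitz.\<close>
    have "absolutely_continuous_on_interval t0 t (\<lambda>t. v t + (b t *\<^sub>R tikhonov t (x t) - H t))"
      using lac \<open>t0 < t\<close> lipschitz_imp_absolutely_continuous[OF L]
      by (intro absolutely_continuous_on_interval_add) (auto simp: locally_absolutely_continuous_def)
    then have "absolutely_continuous_on_interval t0 t (\<lambda>t. y t - H t)"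
      by (simp add: y_def add_diff_eq)
    then have "y t - H t = y t0 - H t0"
    proof (rule absolutely_continuous_zero_derivative[OF _ that N])
      fix s assume s: "s \<in> {t0..t} - N"
      then have "s \<ge> t0" "s \<notin> N" by auto
      then obtain a w where a: "(v has_vector_derivative a) (at s within {t0..})"
        and w: "((\<lambda>s. tikhonov s (x s)) has_vector_derivative w) (at s within {t0..})"
        and eq: "a + p s *\<^sub>R v s + b s *\<^sub>R w + tikhonov s (x s) = 0" using ae by metis
      have "((\<lambda>s. y s - H s) has_vector_derivative a + (b s *\<^sub>R w + b' s *\<^sub>R tikhonov s (x s)) - y' s)
          (at s within {t0..})"
        unfolding y_def using \<open>s \<ge> t0\<close>
        by (intro has_vector_derivative_diff has_vector_derivative_add has_vector_derivative_scaleR a w b H)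
      moreover have "a + (b s *\<^sub>R w + b' s *\<^sub>R tikhonov s (x s)) - y' s
          = a + p s *\<^sub>R v s + b s *\<^sub>R w + tikhonov s (x s)"
        by (simp add: y'_def algebra_simps)
      ultimately have "((\<lambda>s. y s - H s) has_vector_derivative 0) (at s within {t0..})"
        using eq by simp
      then show "((\<lambda>s. y s - H s) has_vector_derivative 0) (at s within {t0..t})"
        by (rule has_vector_derivative_within_subset) auto
    qed
    then show ?thesis by (simp add: H0 algebra_simps)
  qed (simp add: H0)
  have y: "(y has_vector_derivative y' t) (at t within {t0..})" if "t \<ge> t0" for t
  proof -
    have "((\<lambda>s. y t0 + H s) has_vector_derivative y' t) (at t within {t0..})"
      using has_vector_derivative_add[OF has_vector_derivative_const H[OF that]] by simp
    then show ?thesis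
      by (rule has_vector_derivative_transform[rotated 2]) (use that in simp, rule y_eq, simp)
  qed
  show thesis
  proof (rule that[of "\<lambda>t. (x t, y t)"])
    show "(x t0, y t0) = (x0, x1 + b t0 *\<^sub>R tikhonov t0 x0)" by (simp add: y_def init)
    show "((\<lambda>t. (x t, y t)) has_vector_derivative reduced_field t (x t, y t)) (at t within {t0..})"
      if "t \<ge> t0" for t
    proof -
      have "reduced_field t (x t, y t) = (v t, y' t)"
        by (simp add: reduced_field_def reduced_velocity_def y_def y'_def)
      then show ?thesis
        using has_vector_derivative_Pair[OF x[OF that] y[OF that]] by simp
    qed
  qed simp
qed

lemma second_order_solution_unique:
  assumes "second_order_solution x0 x1 x" "second_order_solution x0 x1 x'" "t \<ge> t0"
  shows "x t = x' t"
proof -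
  obtain z where z: "z t0 = (x0, x1 + b t0 *\<^sub>R tikhonov t0 x0)" "\<And>t. fst (z t) = x t"
    "\<And>t. t \<ge> t0 \<Longrightarrow> (z has_vector_derivative reduced_field t (z t)) (at t within {t0..})"
    using second_order_solution_imp_reduced[OF assms(1)] by metis
  obtain z' where z': "z' t0 = (x0, x1 + b t0 *\<^sub>R tikhonov t0 x0)" "\<And>t. fst (z' t) = x' t"
    "\<And>t. t \<ge> t0 \<Longrightarrow> (z' has_vector_derivative reduced_field t (z' t)) (at t within {t0..})"
    using second_order_solution_imp_reduced[OF assms(2)] by metis
  have "z t = z' t"
    using ode_solution_unique[OF continuous_on_reduced_bound reduced_field_lipschitz z(3) z'(3) _ assms(3)] z(1) z'(1)
    by simp
  then show ?thesis using z(2) z'(2) by metis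
qed

end

section \<open>Existence and uniqueness for the Yosida-regularized system\<close>

theorem theorem3p2:
  fixes A :: "'a::{real_inner, complete_space} \<Rightarrow> 'a set"
    and \<rho> \<eta> \<delta> \<gamma> t0 :: real
    and \<epsilon> \<epsilon>' :: "real \<Rightarrow> real"
    and x0 x1 :: 'a
  assumes "maximally_comonotone \<rho> A"
    and "zer A \<noteq> {}"
    and "\<eta> > max (- 2 * \<rho>) 0"
    and "\<delta> > 0"
    and "\<gamma> > 0"
    and "t0 > 0"
    and "\<And>t. t \<ge> t0 \<Longrightarrow> \<epsilon> t > 0"
    and "antimono_on {t0..} \<epsilon>"
    and "\<And>t. t \<ge> t0 \<Longrightarrow> (\<epsilon> has_real_derivative \<epsilon>' t) (at t within {t0..})"
    and "continuous_on {t0..} \<epsilon>'"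
    and "\<And>t. t \<ge> t0 \<Longrightarrow> \<epsilon>' differentiable (at t within {t0..})"
    and "(\<epsilon> \<longlongrightarrow> 0) at_top"
  shows "\<exists>!x. x \<in> {t0..} \<rightarrow>\<^sub>E UNIV \<and> strong_global_solution A \<eta> \<delta> \<gamma> \<epsilon> t0 x0 x1 x"
proof -
  define p where "p t = \<delta> * sqrt (\<epsilon> t)" for t
  define b where "b t = 1 / (\<gamma> * sqrt (\<epsilon> t))" for t
  \<comment> \<open>The derivative of 1/(\<gamma> sqrt \<epsilon>), with the power 3/2 of \<epsilon>
    written as \<epsilon> sqrt \<epsilon>. It is continuous because \<epsilon> is C^1 and
    positive.\<close>
  define b' where "b' t = - \<epsilon>' t / (2 * \<gamma> * \<epsilon> t * sqrt (\<epsilon> t))" for t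
  have \<epsilon>_cont: "continuous_on {t0..} \<epsilon>"
    using DERIV_continuous[OF assms(9)] by (auto simp: continuous_on_eq_continuous_within)
  have Y: "(1 / (\<eta> + \<rho>))-lipschitz_on UNIV (yosida \<eta> A)"
    using assms(1,3) by (rule yosida_lipschitz)
  have p: "continuous_on {t0..} p"
    unfolding p_def by (intro continuous_intros \<epsilon>_cont)
  have b: "(b has_real_derivative b' t) (at t within {t0..})" if "t \<ge> t0" for t
    unfolding b_def b'_def using assms(5) assms(7)[OF that]
    by (auto intro!: derivative_eq_intros assms(9)[OF that] simp: field_simps)
  have b': "continuous_on {t0..} b'"
    unfolding b'_def using assms(5,7) by (intro continuous_intros assms(10) \<epsilon>_cont) force
  note system = Y p b b' assms(9,10)
  have eq: "strong_global_solution A \<eta> \<delta> \<gamma> \<epsilon> t0 x0 x1 x \<longleftrightarrow>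
      second_order_solution (yosida \<eta> A) t0 p b \<epsilon> x0 x1 x" for x
    by (simp only: strong_global_solution_def second_order_solution_def[OF system] tikhonov_def[OF system])
      (simp only: p_def b_def add.assoc)
  obtain x where x: "x \<in> extensional {t0..}" "second_order_solution (yosida \<eta> A) t0 p b \<epsilon> x0 x1 x"
    using second_order_solution_exists[OF system] by blast
  show ?thesis
  proof (rule ex1I[of _ x])
    show "x \<in> {t0..} \<rightarrow>\<^sub>E UNIV \<and> strong_global_solution A \<eta> \<delta> \<gamma> \<epsilon> t0 x0 x1 x"
      using x by (simp add: PiE_def eq)
    fix x' assume x': "x' \<in> {t0..} \<rightarrow>\<^sub>E UNIV \<and> strong_global_solution A \<eta> \<delta> \<gamma> \<epsilon> t0 x0 x1 x'"
    show "x' = x"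
    \<comment> \<open>Solutions are determined only on the half-line; requiring them to be
      extensional fixes their values to the left of \<open>t0\<close>, so agreement there yields
      equality of total functions.\<close>
    proof (rule extensionalityI)
      have "second_order_solution (yosida \<eta> A) t0 p b \<epsilon> x0 x1 x'" using x' by (simp add: eq)
      then show "x' t = x t" if "t \<in> {t0..}" for t
        using second_order_solution_unique[OF system _ x(2)] that by simp
    qed (use x x' in \<open>auto simp: PiE_def\<close>)
  qed
qed

end
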